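(* Let $G$ be a simple graph on $n$ vertices. Let $H$ be the complete graph $K_m$ on a subset of the vertices in $G$. Then $$\beta_{1,\alpha}(H)\le \beta_{1,\alpha}(G)\quad\text{for all multidegrees } \alpha\in\mathbb{Z}^n$$ if and only if $G$ contains $H=K_m$ as a subgraph.
   Context: Graphs are finite and simple (no loops, no multiple edges). The complete graph $K_m$ is the graph on $m$ vertices in which any pair of vertices is connected by an edge. A graph $F$ is a subgraph of $G$ if the vertices of $F$ are vertices of $G$ and the edges of $F$ are edges of $G$. Let $V=\{x_1,\dots,x_n\}$ be the vertex set of $G$, let $k$ be a field, and let $R=k[x_1,\dots,x_n]$, with variables identified with the vertices and with the $\mathbb{Z}^n$-grading in which $\deg(x_i)=\mathbf{e}_i$ is the $i$th standard unit vector. The edge ideal of a graph $F$ whose vertex set is contained in $V$ is $I(F)=\langle xy : xy \text{ is an edge of } F\rangle\subseteq R$. For such $F$, $i\ge 0$ and $\alpha\in\mathbb{Z}^n$, $\beta_{i,\alpha}(F)$ denotes the $i$th $\mathbb{Z}^n$-graded (multigraded) Betti number of the ideal $I(F)$, regarded as an $R$-module (not of $R/I(F)$), in degree $\alpha$: the minimal $\mathbb{Z}^n$-graded free resolution of $I(F)$ over $R$ has $\bigoplus_{\alpha}R(-\alpha)^{\beta_{i,\alpha}(F)}$ in homological degree $i$.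
   Formalization: The case m = 2 is excluded: there I(H) is principal, so all first Betti numbers of H vanish and the inequality holds even when G does not contain the edge, making the equivalence false. *)

theory Defs
  imports "Graph_Theory.Graph_Theory" "HOL-Library.Poly_Mapping"
begin

text \<open>The polynomial ring over the field \<open>'k\<close> whose variables are the elements of \<open>'v\<close>:
  finitely supported functions from exponent vectors to coefficients, with the convolution product
  of \<^theory>\<open>HOL-Library.Poly_Mapping\<close>.\<close>

type_synonym 'v mdeg = "'v \<Rightarrow> int"
type_synonym ('v, 'k) mpoly = "('v \<Rightarrow>\<^sub>0 nat) \<Rightarrow>\<^sub>0 'k"

definition var :: "'v \<Rightarrow> ('v, 'k::field) mpoly" where
  "var x = Poly_Mapping.single (Poly_Mapping.single x 1) 1"

text \<open>The zero polynomial is homogeneous of every degree.\<close>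

definition homogeneous :: "'v mdeg \<Rightarrow> ('v, 'k::field) mpoly \<Rightarrow> bool" where
  "homogeneous \<alpha> p \<longleftrightarrow>
     (\<forall>t\<in>Poly_Mapping.keys p. \<forall>v. int (Poly_Mapping.lookup t v) = \<alpha> v)"

abbreviation ideal_gen :: "('v, 'k::field) mpoly set \<Rightarrow> ('v, 'k) mpoly set" where
  "ideal_gen \<equiv> module.span (*)"

definition irrelevant_ideal :: "('v, 'k::field) mpoly set" where
  "irrelevant_ideal = ideal_gen (range var)"

text \<open>A graph is a symmetric loop-free digraph (\<^locale>\<open>pair_graph\<close>), so that each edge
  \<open>xy\<close> occurs as the two arcs \<open>(x, y)\<close> and \<open>(y, x)\<close>, which give the same generator.\<close>

definition edge_ideal :: "'v pair_pre_digraph \<Rightarrow> ('v, 'k::field) mpoly set" where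
  "edge_ideal F = ideal_gen {var x * var y | x y. (x, y) \<in> parcs F}"

text \<open>For \<open>b\<close> assigning a rank to each multidegree, \<open>free_mod b\<close> is the free module
  \<open>\<Oplus>\<^sub>\<alpha> R(-\<alpha>)\<^bsup>b \<alpha>\<^esup>\<close>, with a basis indexed by the pairs \<open>(\<alpha>, j)\<close>, \<open>j < b \<alpha>\<close>; the
  basis element at \<open>(\<alpha>, j)\<close> has degree \<open>\<alpha>\<close>. All these modules live in one ambient type of
  finitely supported coordinate vectors.\<close>

type_synonym ('v, 'k) free_vec = "('v mdeg \<times> nat) \<Rightarrow>\<^sub>0 ('v, 'k) mpoly"

definition scale_vec :: "('v, 'k::field) mpoly \<Rightarrow> ('v, 'k) free_vec \<Rightarrow> ('v, 'k) free_vec" where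
  "scale_vec r = Poly_Mapping.map ((*) r)"

lemma lookup_scale_vec:
  "Poly_Mapping.lookup (scale_vec r u) i = r * Poly_Mapping.lookup u i"
  unfolding scale_vec_def by transfer (simp add: when_def)

lemma module_scale_vec: "module scale_vec"
  by unfold_locales
    (auto intro!: poly_mapping_eqI simp: lookup_scale_vec lookup_add algebra_simps)

definition free_mod :: "('v mdeg \<Rightarrow> nat) \<Rightarrow> ('v, 'k::field) free_vec set" where
  "free_mod b = {u. \<forall>(\<alpha>, j)\<in>Poly_Mapping.keys u. j < b \<alpha>}"

definition homogeneous_vec :: "'v mdeg \<Rightarrow> ('v, 'k::field) free_vec \<Rightarrow> bool" where
  "homogeneous_vec \<gamma> u \<longleftrightarrow>
     (\<forall>\<alpha> j. homogeneous (\<lambda>v. \<gamma> v - \<alpha> v) (Poly_Mapping.lookup u (\<alpha>, j)))"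

text \<open>Minimal multigraded free resolutions of a multigraded ideal \<open>I\<close>,
  \<open>\<dots> \<rightarrow> F\<^sub>2 \<rightarrow> F\<^sub>1 \<rightarrow> F\<^sub>0 \<rightarrow> I \<rightarrow> 0\<close>, where \<open>F\<^sub>i = free_mod (b i)\<close>, the map \<open>F\<^sub>i\<^sub>+\<^sub>1 \<rightarrow> F\<^sub>i\<close> is
  \<open>d i\<close>, and \<open>F\<^sub>0 \<rightarrow> I\<close> is \<open>e\<close>.
  The maps are taken linear on the whole ambient type, but only their restrictions to the \<open>F\<^sub>i\<close>
  matter: a linear map on \<open>F\<^sub>i\<close> extends by zero on the remaining basis vectors. The maps preserve
  degrees, and minimality is \<open>d i (F\<^sub>i\<^sub>+\<^sub>1) \<subseteq> \<mm> F\<^sub>i\<close>, tested on coordinates. Only the rank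
  in each single multidegree is required to be finite.\<close>

definition minimal_free_resolution ::
  "('v, 'k::field) mpoly set \<Rightarrow> (nat \<Rightarrow> 'v mdeg \<Rightarrow> nat) \<Rightarrow>
   (nat \<Rightarrow> ('v, 'k) free_vec \<Rightarrow> ('v, 'k) free_vec) \<Rightarrow>
   (('v, 'k) free_vec \<Rightarrow> ('v, 'k) mpoly) \<Rightarrow> bool" where
  "minimal_free_resolution I b d e \<longleftrightarrow>
     module_hom scale_vec (*) e \<and>
     (\<forall>u\<in>free_mod (b 0). \<forall>\<gamma>. homogeneous_vec \<gamma> u \<longrightarrow> homogeneous \<gamma> (e u)) \<and>
     e ` free_mod (b 0) = I \<and>
     (\<forall>i. module_hom scale_vec scale_vec (d i) \<and>
          d i ` free_mod (b (Suc i)) \<subseteq> free_mod (b i) \<and>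
          (\<forall>u\<in>free_mod (b (Suc i)). \<forall>\<gamma>. homogeneous_vec \<gamma> u \<longrightarrow> homogeneous_vec \<gamma> (d i u))) \<and>
     {u \<in> free_mod (b 0). e u = 0} = d 0 ` free_mod (b 1) \<and>
     (\<forall>i. {u \<in> free_mod (b (Suc i)). d i u = 0} = d (Suc i) ` free_mod (b (Suc (Suc i)))) \<and>
     (\<forall>i. \<forall>u\<in>free_mod (b (Suc i)). \<forall>c. Poly_Mapping.lookup (d i u) c \<in> irrelevant_ideal)"

text \<open>The ideal itself, not the quotient by it, is resolved. The description is only meaningful
  for multigraded ideals, for which the ranks of a minimal resolution are uniquely determined.\<close>

definition betti :: "('v, 'k::field) mpoly set \<Rightarrow> nat \<Rightarrow> 'v mdeg \<Rightarrow> nat" where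
  "betti I i \<alpha> = (THE c. \<exists>b d e. minimal_free_resolution I b d e \<and> b i \<alpha> = c)"

definition graph_betti :: "'k::field itself \<Rightarrow> nat \<Rightarrow> 'v mdeg \<Rightarrow> 'v pair_pre_digraph \<Rightarrow> nat" where
  "graph_betti _ i \<alpha> F = betti (edge_ideal F :: ('v, 'k) mpoly set) i \<alpha>"

end

theory Submission
  imports Defs "HOL-Library.Function_Algebras"
begin

text \<open>
  If \<open>F\<^sub>0 \<rightarrow> I(F)\<close> is the start of a minimal multigraded resolution and \<open>K\<close> is its kernel, then
  \<open>\<beta>\<^sub>1\<^sub>,\<^sub>\<gamma>(F) = dim K\<^sub>\<gamma> - dim (\<mm>K)\<^sub>\<gamma>\<close>. The basis of \<open>F\<^sub>0\<close> is indexed by the edges of \<open>F\<close>, and in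
  degree \<open>\<gamma>\<close> the kernel consists of the scalar weights of sum zero on the edges \<open>xy\<close> with
  \<open>deg(xy) \<le> \<gamma>\<close>, while \<open>(\<mm>K)\<^sub>\<gamma>\<close> is spanned by those supported on the edges with
  \<open>deg(xy) \<le> \<gamma> - \<e>\<^sub>v\<close> for some vertex \<open>v\<close>.

  If \<open>H \<subseteq> G\<close> is complete on \<open>S\<close>, then \<open>G\<close> and \<open>H\<close> have the same edges below every \<open>\<gamma>\<close> supported
  on \<open>S\<close>, so the two Betti numbers agree; for every other \<open>\<gamma>\<close> one has \<open>\<beta>\<^sub>1\<^sub>,\<^sub>\<gamma>(H) = 0\<close>. Conversely, for
  distinct \<open>x, y, z \<in> S\<close> the number \<open>\<beta>\<^sub>1(H)\<close> in degree \<open>\<e>\<^sub>x + \<e>\<^sub>y + \<e>\<^sub>z\<close> is \<open>2\<close>, and that of \<open>G\<close> is at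
  most \<open>1\<close> unless \<open>x, y, z\<close> span a triangle in \<open>G\<close>.

  The Betti numbers are defined by a definite description, so a minimal resolution must also be
  shown to exist; it is built by choosing minimal generators of one kernel after the other.
\<close>

subsection \<open>Multidegrees and homogeneous components\<close>

definition mono_deg :: "('v \<Rightarrow>\<^sub>0 nat) \<Rightarrow> 'v mdeg" where
  "mono_deg t = (\<lambda>v. int (Poly_Mapping.lookup t v))"

text \<open>Negative entries are cut off at 0, so this inverts \<open>mono_deg\<close> only on
  degrees \<ge> 0. Finiteness of the vertex type makes every exponent function finitely
  supported.\<close>

definition deg_mono :: "'v::finite mdeg \<Rightarrow> ('v \<Rightarrow>\<^sub>0 nat)" where
  "deg_mono \<beta> = Abs_poly_mapping (\<lambda>v. nat (\<beta> v))"

definition unit_deg :: "'v \<Rightarrow> 'v mdeg" where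
  "unit_deg v = (\<lambda>w. of_bool (w = v))"

lemma mono_deg_simps [simp]:
  "mono_deg 0 = 0" "mono_deg (s + t) = mono_deg s + mono_deg t" "0 \<le> mono_deg t"
  "mono_deg s = mono_deg t \<longleftrightarrow> s = t"
  by (auto simp: mono_deg_def fun_eq_iff lookup_add le_fun_def poly_mapping_eq_iff)

lemma mono_deg_single: "mono_deg (Poly_Mapping.single v 1) = unit_deg v"
  by (auto simp: mono_deg_def unit_deg_def lookup_single when_def fun_eq_iff)

lemma mono_deg_deg_mono [simp]: "0 \<le> \<beta> \<Longrightarrow> mono_deg (deg_mono \<beta>) = \<beta>"
  by (simp add: mono_deg_def deg_mono_def le_fun_def fun_eq_iff)

lemma deg_mono_mono_deg [simp]: "deg_mono (mono_deg t) = t"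
  by (rule poly_mapping_eqI) (simp add: mono_deg_def deg_mono_def)

lemma unit_deg_nonneg [simp]: "0 \<le> unit_deg v"
  by (simp add: unit_deg_def le_fun_def)

lemma homogeneous_iff: "homogeneous \<beta> p \<longleftrightarrow> (\<forall>t\<in>Poly_Mapping.keys p. mono_deg t = \<beta>)"
  by (auto simp: homogeneous_def mono_deg_def fun_eq_iff)

lemma homogeneous_0 [simp]: "homogeneous \<beta> 0"
  by (simp add: homogeneous_iff)

lemma homogeneous_single: "homogeneous (mono_deg t) (Poly_Mapping.single t c)"
  by (simp add: homogeneous_iff)

lemma homogeneous_add: "homogeneous \<beta> p \<Longrightarrow> homogeneous \<beta> q \<Longrightarrow> homogeneous \<beta> (p + q)"
  unfolding homogeneous_iff using keys_add[of p q] by blast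

lemma homogeneous_mult: "homogeneous \<beta> p \<Longrightarrow> homogeneous \<delta> q \<Longrightarrow> homogeneous (\<beta> + \<delta>) (p * q)"
  unfolding homogeneous_iff using keys_mult[of p q] by fastforce

text \<open>A multidegree determines its monomial, so each graded piece of the polynomial ring is at
  most one-dimensional over the field. All later reductions to scalars rest on this.\<close>

lemma homogeneous_cases:
  assumes "homogeneous \<beta> p" "p \<noteq> 0"
  obtains t c where "mono_deg t = \<beta>" "p = Poly_Mapping.single t c" "c \<noteq> 0"
proof -
  obtain t where t: "t \<in> Poly_Mapping.keys p"
    using assms(2) by fastforce
  have "p = Poly_Mapping.single t (Poly_Mapping.lookup p t)"
  proof (rule poly_mapping_eqI)
    fix s show "Poly_Mapping.lookup p s
        = Poly_Mapping.lookup (Poly_Mapping.single t (Poly_Mapping.lookup p t)) s"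
      using assms(1) t mono_deg_simps(4)[of s t]
      by (cases "s = t") (auto simp: homogeneous_iff lookup_single when_def in_keys_iff)
  qed
  then show ?thesis
    using that t assms(1) by (auto simp: homogeneous_iff in_keys_iff)
qed

lemma homogeneous_nonneg: "homogeneous \<beta> p \<Longrightarrow> p \<noteq> 0 \<Longrightarrow> 0 \<le> \<beta>"
  by (metis homogeneous_cases mono_deg_simps(3))

definition hcomp :: "'v mdeg \<Rightarrow> ('v, 'k::field) mpoly \<Rightarrow> ('v, 'k) mpoly" where
  "hcomp \<beta> p = Poly_Mapping.mapp (\<lambda>t c. c when mono_deg t = \<beta>) p"

lemma lookup_hcomp: "Poly_Mapping.lookup (hcomp \<beta> p) t = (Poly_Mapping.lookup p t when mono_deg t = \<beta>)"
  by (auto simp: hcomp_def lookup_mapp when_def in_keys_iff)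

lemma hcomp_add: "hcomp \<beta> (p + q) = hcomp \<beta> p + hcomp \<beta> q"
  by (rule poly_mapping_eqI) (auto simp: lookup_hcomp lookup_add when_def)

lemma hcomp_0 [simp]: "hcomp \<beta> 0 = 0"
  by (rule poly_mapping_eqI) (auto simp: lookup_hcomp)

lemma homogeneous_hcomp [simp]: "homogeneous \<beta> (hcomp \<beta> p)"
  by (auto simp: homogeneous_iff in_keys_iff lookup_hcomp when_def split: if_splits)

lemma hcomp_homogeneous: "homogeneous \<beta> p \<Longrightarrow> hcomp \<delta> p = (p when \<delta> = \<beta>)"
  by (rule poly_mapping_eqI)
    (auto simp: homogeneous_iff in_keys_iff lookup_hcomp when_def)

lemma homogeneous_vec_iff:
  "homogeneous_vec \<gamma> u \<longleftrightarrow> (\<forall>i. homogeneous (\<gamma> - fst i) (Poly_Mapping.lookup u i))"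
  by (simp add: homogeneous_vec_def fun_diff_def)

lemma homogeneous_vec_0 [simp]: "homogeneous_vec \<gamma> 0"
  by (simp add: homogeneous_vec_iff)

lemma homogeneous_vec_add:
  "homogeneous_vec \<gamma> u \<Longrightarrow> homogeneous_vec \<gamma> w \<Longrightarrow> homogeneous_vec \<gamma> (u + w)"
  by (simp add: homogeneous_vec_iff lookup_add homogeneous_add)

lemma homogeneous_vec_scale:
  "homogeneous \<beta> p \<Longrightarrow> homogeneous_vec \<gamma> u \<Longrightarrow> homogeneous_vec (\<beta> + \<gamma>) (scale_vec p u)"
  by (simp add: homogeneous_vec_iff lookup_scale_vec add_diff_eq[symmetric] homogeneous_mult)

lemma homogeneous_vec_single:
  "homogeneous \<beta> p \<Longrightarrow> homogeneous_vec (\<beta> + fst i) (Poly_Mapping.single i p)"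
  by (simp add: homogeneous_vec_iff lookup_single when_def)

lemma homogeneous_vec_basis: "homogeneous_vec \<alpha> (Poly_Mapping.single (\<alpha>, j) 1)"
  using homogeneous_vec_single[of 0 1 "(\<alpha>, j)"] by (simp add: homogeneous_iff)

definition comp_vec :: "'v mdeg \<Rightarrow> ('v, 'k::field) free_vec \<Rightarrow> ('v, 'k) free_vec" where
  "comp_vec \<gamma> u = Poly_Mapping.mapp (\<lambda>i p. hcomp (\<gamma> - fst i) p) u"

lemma lookup_comp_vec:
  "Poly_Mapping.lookup (comp_vec \<gamma> u) i = hcomp (\<gamma> - fst i) (Poly_Mapping.lookup u i)"
  by (auto simp: comp_vec_def lookup_mapp when_def in_keys_iff)

lemma comp_vec_add: "comp_vec \<gamma> (u + w) = comp_vec \<gamma> u + comp_vec \<gamma> w"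
  by (rule poly_mapping_eqI) (simp add: lookup_comp_vec lookup_add hcomp_add)

lemma comp_vec_0 [simp]: "comp_vec \<gamma> 0 = 0"
  by (rule poly_mapping_eqI) (simp add: lookup_comp_vec)

lemma comp_vec_sum: "comp_vec \<gamma> (sum f A) = (\<Sum>a\<in>A. comp_vec \<gamma> (f a))"
  by (induction A rule: infinite_finite_induct) (simp_all add: comp_vec_add)

lemma homogeneous_comp_vec [simp]: "homogeneous_vec \<gamma> (comp_vec \<gamma> u)"
  by (simp add: homogeneous_vec_iff lookup_comp_vec)

lemma comp_vec_homogeneous:
  assumes "homogeneous_vec \<gamma> u"
  shows "comp_vec \<delta> u = (u when \<delta> = \<gamma>)"
proof (rule poly_mapping_eqI)
  fix i
  have "hcomp (\<delta> - fst i) (Poly_Mapping.lookup u i)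
      = (Poly_Mapping.lookup u i when \<delta> - fst i = \<gamma> - fst i)"
    using assms unfolding homogeneous_vec_iff by (intro hcomp_homogeneous) blast
  then show "Poly_Mapping.lookup (comp_vec \<delta> u) i = Poly_Mapping.lookup (u when \<delta> = \<gamma>) i"
    by (simp add: lookup_comp_vec when_def)
qed

lemma keys_comp_vec: "Poly_Mapping.keys (comp_vec \<gamma> u) \<subseteq> Poly_Mapping.keys u"
  unfolding comp_vec_def by (rule keys_mapp_subset)

lemma comp_vec_decomposition:
  obtains S where "finite S" "u = (\<Sum>\<gamma>\<in>S. comp_vec \<gamma> u)"
proof
  \<comment> \<open>The degrees of all terms of \<open>u\<close>: a monomial in the coordinate at
    \<open>i\<close> adds its own degree to that of the basis vector.\<close>
  define S where "S = (\<Union>i\<in>Poly_Mapping.keys u.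
      (\<lambda>t. fst i + mono_deg t) ` Poly_Mapping.keys (Poly_Mapping.lookup u i))"
  show "finite S"
    by (simp add: S_def)
  have "Poly_Mapping.lookup (Poly_Mapping.lookup u i) t
      = (\<Sum>\<gamma>\<in>S. Poly_Mapping.lookup (Poly_Mapping.lookup u i) t when mono_deg t = \<gamma> - fst i)" for i t
  proof (cases "Poly_Mapping.lookup (Poly_Mapping.lookup u i) t = 0")
    case False
    then have "fst i + mono_deg t \<in> S"
      by (force simp: S_def in_keys_iff)
    moreover have "mono_deg t = \<gamma> - fst i \<longleftrightarrow> \<gamma> = fst i + mono_deg t" for \<gamma>
      by (auto simp: algebra_simps)
    ultimately show ?thesis
      using \<open>finite S\<close> by (simp add: when_def)
  qed simp
  then show "u = (\<Sum>\<gamma>\<in>S. comp_vec \<gamma> u)"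
    by (intro poly_mapping_eqI) (simp add: lookup_sum lookup_comp_vec lookup_hcomp)
qed

subsection \<open>Free modules and graded submodules\<close>

interpretation vec: module scale_vec
  by (rule module_scale_vec)

text \<open>The field acts through constant polynomials; ranks will be read off from dimensions over
  it inside single degrees.\<close>

definition kscale :: "'k \<Rightarrow> ('v, 'k::field) free_vec \<Rightarrow> ('v, 'k) free_vec" where
  "kscale c = scale_vec (Poly_Mapping.single 0 c)"

interpretation kv: vector_space kscale
  by unfold_locales
    (simp_all add: kscale_def vec.scale_right_distrib single_add vec.scale_left_distrib mult_single)

lemma scale_vec_single [simp]:
  "scale_vec p (Poly_Mapping.single i q) = Poly_Mapping.single i (p * q)"
  by (rule poly_mapping_eqI) (simp add: lookup_scale_vec lookup_single when_def)

lemma vec_expansion: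
  "u = (\<Sum>i\<in>Poly_Mapping.keys u. scale_vec (Poly_Mapping.lookup u i) (Poly_Mapping.single i 1))"
  by (rule poly_mapping_eqI) (auto simp: lookup_sum lookup_single when_def in_keys_iff)

lemma free_mod_iff: "u \<in> free_mod b \<longleftrightarrow> (\<forall>i\<in>Poly_Mapping.keys u. snd i < b (fst i))"
  by (auto simp: free_mod_def)

lemma free_mod_lookup: "u \<in> free_mod b \<Longrightarrow> Poly_Mapping.lookup u i \<noteq> 0 \<Longrightarrow> snd i < b (fst i)"
  by (simp add: free_mod_iff in_keys_iff)

lemma single_in_free_mod: "j < b \<alpha> \<Longrightarrow> Poly_Mapping.single (\<alpha>, j) p \<in> free_mod b"
  by (simp add: free_mod_iff)

lemma keys_scale_vec: "Poly_Mapping.keys (scale_vec p u) \<subseteq> Poly_Mapping.keys u"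
  by (auto simp: in_keys_iff lookup_scale_vec)

lemma subspace_free_mod: "vec.subspace (free_mod b)"
proof (rule vec.subspaceI)
  show "x + y \<in> free_mod b" if "x \<in> free_mod b" "y \<in> free_mod b" for x y :: "('a, 'b) free_vec"
    using that keys_add[of x y] unfolding free_mod_iff by blast
  show "scale_vec c x \<in> free_mod b" if "x \<in> free_mod b" for c and x :: "('a, 'b) free_vec"
    using that keys_scale_vec[of c x] unfolding free_mod_iff by blast
qed (simp add: free_mod_iff)

lemma comp_vec_in_free_mod: "u \<in> free_mod b \<Longrightarrow> comp_vec \<gamma> u \<in> free_mod b"
  using keys_comp_vec[of \<gamma> u] by (auto simp: free_mod_iff)

lemma subspace_vec_imp_kv: "vec.subspace M \<Longrightarrow> kv.subspace M"
  by (auto simp: vec.subspace_def kv.subspace_def kscale_def)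

lemma homogeneous_const: "homogeneous 0 (Poly_Mapping.single 0 c)"
  using homogeneous_single[of 0 c] by simp

lemma homogeneous_vec_kscale: "homogeneous_vec \<gamma> u \<Longrightarrow> homogeneous_vec \<gamma> (kscale c u)"
  using homogeneous_vec_scale[OF homogeneous_const, of \<gamma> u c] by (simp add: kscale_def)

definition hpart :: "('v, 'k::field) free_vec set \<Rightarrow> 'v mdeg \<Rightarrow> ('v, 'k) free_vec set" where
  "hpart M \<gamma> = {u \<in> M. homogeneous_vec \<gamma> u}"

text \<open>The degree \<open>\<gamma>\<close> part of \<open>\<mm>M\<close> is the \<open>k\<close>-span of the following set.\<close>

definition mpart :: "('v, 'k::field) free_vec set \<Rightarrow> 'v mdeg \<Rightarrow> ('v, 'k) free_vec set" where
  "mpart M \<gamma> = (\<Union>v. scale_vec (var v) ` hpart M (\<gamma> - unit_deg v))"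

lemma subspace_hpart: "vec.subspace M \<Longrightarrow> kv.subspace (hpart M \<gamma>)"
  by (drule subspace_vec_imp_kv)
    (auto simp: kv.subspace_def hpart_def homogeneous_vec_add homogeneous_vec_kscale)

lemma homogeneous_var: "homogeneous (unit_deg v) (var v)"
  unfolding var_def using homogeneous_single[of "Poly_Mapping.single v 1" 1]
  by (simp only: mono_deg_single)

lemma mpart_subset_hpart:
  assumes "vec.subspace M"
  shows "mpart M \<gamma> \<subseteq> hpart M \<gamma>"
proof
  fix w assume "w \<in> mpart M \<gamma>"
  then obtain v u where "u \<in> M" "homogeneous_vec (\<gamma> - unit_deg v) u" "w = scale_vec (var v) u"
    by (auto simp: mpart_def hpart_def)
  moreover from this have "homogeneous_vec (unit_deg v + (\<gamma> - unit_deg v)) w"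
    by (simp only: homogeneous_vec_scale[OF homogeneous_var])
  ultimately show "w \<in> hpart M \<gamma>"
    using assms by (simp add: hpart_def vec.subspace_scale)
qed

lemma span_mpart_subset_hpart: "vec.subspace M \<Longrightarrow> kv.span (mpart M \<gamma>) \<subseteq> hpart M \<gamma>"
  by (intro kv.span_minimal mpart_subset_hpart subspace_hpart)

definition graded_submodule :: "('v, 'k::field) free_vec set \<Rightarrow> bool" where
  "graded_submodule M \<longleftrightarrow> vec.subspace M \<and> (\<forall>u\<in>M. \<forall>\<gamma>. comp_vec \<gamma> u \<in> M)"

text \<open>A nonzero homogeneous \<open>p\<close> is a scaled monomial. In degree 0 it is a
  constant, found at the exponent 0; otherwise some variable divides it, and splitting that variable
  off puts the product into \<open>mpart M \<gamma>\<close>.\<close>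

lemma scale_homogeneous_cases:
  assumes M: "vec.subspace M" and u: "u \<in> hpart M \<alpha>" and p: "homogeneous (\<gamma> - \<alpha>) p"
  shows "(if \<alpha> = \<gamma> then scale_vec p u = kscale (Poly_Mapping.lookup p 0) u
    else scale_vec p u \<in> kv.span (mpart M \<gamma>))"
proof (cases "p = 0")
  case True
  then show ?thesis
    by (auto intro: kv.span_zero)
next
  case False
  then obtain t c where t: "mono_deg t = \<gamma> - \<alpha>" "p = Poly_Mapping.single t c"
    using p homogeneous_cases by blast
  show ?thesis
  proof (cases "\<alpha> = \<gamma>")
    case True
    then have "t = 0"
      using t(1) mono_deg_simps(4)[of t 0] by simp
    then show ?thesis
      using t True by (simp add: kscale_def)
  next
    case False
    then have "t \<noteq> 0"
      using t by auto
    then obtain v where v: "Poly_Mapping.lookup t v \<noteq> 0"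
      by (metis poly_mapping_eqI lookup_zero)
    \<comment> \<open>The truncated subtraction is exact, because \<open>v\<close> occurs in
      \<open>t\<close>.\<close>
    define s where "s = t - Poly_Mapping.single v 1"
    have ts: "t = Poly_Mapping.single v 1 + s"
      using v by (intro poly_mapping_eqI) (auto simp: s_def lookup_add lookup_minus lookup_single when_def)
    have "mono_deg s + \<alpha> = \<gamma> - unit_deg v"
      using t(1) unfolding ts mono_deg_simps mono_deg_single by (simp add: algebra_simps)
    moreover have "homogeneous_vec (mono_deg s + \<alpha>) (scale_vec (Poly_Mapping.single s c) u)"
      using u by (intro homogeneous_vec_scale homogeneous_single) (simp add: hpart_def)
    ultimately have "scale_vec (Poly_Mapping.single s c) u \<in> hpart M (\<gamma> - unit_deg v)"
      using u M by (simp add: hpart_def vec.subspace_scale)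
    moreover have "p = var v * Poly_Mapping.single s c"
      unfolding t(2) ts var_def by (simp add: mult_single)
    ultimately have "scale_vec p u \<in> mpart M \<gamma>"
      by (auto simp: mpart_def simp flip: vec.scale_scale)
    then show ?thesis
      using False by (simp add: kv.span_base)
  qed
qed

lemma module_hom_kscale:
  assumes "module_hom scale_vec scale_vec d"
  shows "Vector_Spaces.linear kscale kscale d"
proof -
  interpret d: module_hom scale_vec scale_vec d by fact
  show ?thesis
    by unfold_locales (simp_all add: d.add d.scale kscale_def)
qed

lemma module_hom_expansion:
  assumes "module_hom scale_vec s d"
  shows "d u = (\<Sum>i\<in>Poly_Mapping.keys u. s (Poly_Mapping.lookup u i) (d (Poly_Mapping.single i 1)))"
proof -
  interpret d: module_hom scale_vec s d by fact
  show ?thesis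
    by (subst vec_expansion) (simp only: d.sum d.scale)
qed

text \<open>Both sides agree on homogeneous vectors, whose degree \<open>d\<close> preserves, and
  \<open>u\<close> is a finite sum of such vectors.\<close>

lemma comp_vec_module_hom:
  assumes d: "module_hom scale_vec scale_vec d"
    and deg: "\<And>u \<gamma>. u \<in> free_mod b \<Longrightarrow> homogeneous_vec \<gamma> u \<Longrightarrow> homogeneous_vec \<gamma> (d u)"
    and u: "u \<in> free_mod b"
  shows "comp_vec \<gamma> (d u) = d (comp_vec \<gamma> u)"
proof -
  interpret d: module_hom scale_vec scale_vec d by fact
  obtain S where S: "finite S" "u = (\<Sum>\<delta>\<in>S. comp_vec \<delta> u)"
    by (rule comp_vec_decomposition)
  have *: "comp_vec \<gamma> (d (comp_vec \<delta> u)) = d (comp_vec \<gamma> (comp_vec \<delta> u))" for \<delta>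
    by (simp add: comp_vec_homogeneous[OF deg[OF comp_vec_in_free_mod[OF u] homogeneous_comp_vec]]
        comp_vec_homogeneous[OF homogeneous_comp_vec] when_def d.zero)
  have "comp_vec \<gamma> (d (\<Sum>\<delta>\<in>S. comp_vec \<delta> u)) = d (comp_vec \<gamma> (\<Sum>\<delta>\<in>S. comp_vec \<delta> u))"
    by (simp add: d.sum comp_vec_sum *)
  then show ?thesis
    using S(2) by simp
qed

subsection \<open>Minimal covers\<close>

lemma single_add_neq_0: "Poly_Mapping.single v 1 + t \<noteq> (0 :: 'v \<Rightarrow>\<^sub>0 nat)"
proof
  assume "Poly_Mapping.single v 1 + t = 0"
  then have "Poly_Mapping.lookup (Poly_Mapping.single v 1 + t) v = 0"
    by simp
  then show False
    by (simp add: lookup_add)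
qed

lemma lookup_var_mult_0 [simp]: "Poly_Mapping.lookup (var v * p) 0 = 0"
  for p :: "('v, 'k::field) mpoly"
proof (rule ccontr)
  assume "Poly_Mapping.lookup (var v * p) 0 \<noteq> 0"
  then have "0 \<in> Poly_Mapping.keys (var v * p)"
    by (simp add: in_keys_iff)
  then obtain s t where "0 = s + t" "s \<in> Poly_Mapping.keys (var v :: ('v, 'k) mpoly)"
    using keys_mult[of "var v" p] by blast
  moreover from this(2) have "s = Poly_Mapping.single v 1"
    by (simp add: var_def)
  ultimately show False
    using single_add_neq_0[of v t] by metis
qed

lemma lookup_const_mult: "Poly_Mapping.lookup (Poly_Mapping.single 0 c * p) t = c * Poly_Mapping.lookup p t"
  for p :: "('v, 'k::field) mpoly"
  by (simp add: mult_map_scale_conv_mult[symmetric] Poly_Mapping.map.rep_eq when_def)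

lemma lookup_kscale:
  "Poly_Mapping.lookup (Poly_Mapping.lookup (kscale c u) i) t
    = c * Poly_Mapping.lookup (Poly_Mapping.lookup u i) t"
  by (simp add: kscale_def lookup_scale_vec lookup_const_mult)

text \<open>The last clause places the kernel in the irrelevant ideal times
  \<open>free_mod b\<close>, so the images of the basis vectors form a minimal generating set of
  \<open>M\<close>. Every map of a minimal resolution covers its image in this sense.\<close>

definition minimal_cover :: "('v mdeg \<Rightarrow> nat) \<Rightarrow> (('v, 'k::field) free_vec \<Rightarrow> ('v, 'k) free_vec) \<Rightarrow>
    ('v, 'k) free_vec set \<Rightarrow> bool" where
  "minimal_cover b d M \<longleftrightarrow> module_hom scale_vec scale_vec d \<and> d ` free_mod b = M \<and>
     (\<forall>u\<in>free_mod b. \<forall>\<gamma>. homogeneous_vec \<gamma> u \<longrightarrow> homogeneous_vec \<gamma> (d u)) \<and>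
     (\<forall>u\<in>free_mod b. d u = 0 \<longrightarrow> (\<forall>i. Poly_Mapping.lookup (Poly_Mapping.lookup u i) 0 = 0))"

context
  fixes b :: "'v mdeg \<Rightarrow> nat" and d :: "('v, 'k::field) free_vec \<Rightarrow> ('v, 'k) free_vec" and M
  assumes cover: "minimal_cover b d M"
begin

interpretation d: module_hom scale_vec scale_vec d
  using cover by (simp add: minimal_cover_def)

lemma subspace_cover: "vec.subspace M"
proof -
  have "vec.subspace (d ` free_mod b)"
    by (intro d.subspace_image subspace_free_mod)
  then show ?thesis
    using cover by (simp add: minimal_cover_def)
qed

lemma cover_homogeneous: "u \<in> free_mod b \<Longrightarrow> homogeneous_vec \<gamma> u \<Longrightarrow> d u \<in> hpart M \<gamma>"
  using cover by (auto simp: minimal_cover_def hpart_def)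

lemma cover_basis: "j < b \<alpha> \<Longrightarrow> d (Poly_Mapping.single (\<alpha>, j) 1) \<in> hpart M \<alpha>"
  by (intro cover_homogeneous single_in_free_mod homogeneous_vec_basis)

text \<open>Lift to the free module and keep the component of degree \<gamma>. Basis vectors of
  degree \<gamma> enter with field coefficients; all others contribute to the span of
  \<open>mpart M \<gamma>\<close>.\<close>

lemma cover_span:
  "hpart M \<gamma> \<subseteq> kv.span (mpart M \<gamma> \<union> (\<lambda>j. d (Poly_Mapping.single (\<gamma>, j) 1)) ` {..<b \<gamma>})"
proof
  fix u assume u: "u \<in> hpart M \<gamma>"
  then obtain w where w: "w \<in> free_mod b" "u = d w"
    using cover by (auto simp: minimal_cover_def hpart_def)
  let ?w = "comp_vec \<gamma> w"
  have "u = comp_vec \<gamma> u"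
    using u comp_vec_homogeneous[of \<gamma> u \<gamma>] by (simp add: hpart_def)
  also have "\<dots> = d ?w"
    unfolding w(2) using cover w(1)
    by (intro comp_vec_module_hom) (auto simp: minimal_cover_def)
  also have "\<dots> = (\<Sum>i\<in>Poly_Mapping.keys ?w.
      scale_vec (Poly_Mapping.lookup ?w i) (d (Poly_Mapping.single i 1)))"
    by (rule module_hom_expansion) (rule d.module_hom_axioms)
  also have "\<dots> \<in> kv.span (mpart M \<gamma> \<union> (\<lambda>j. d (Poly_Mapping.single (\<gamma>, j) 1)) ` {..<b \<gamma>})"
    (is "_ \<in> kv.span ?S")
  proof (rule kv.span_sum)
    fix i assume "i \<in> Poly_Mapping.keys ?w"
    then have i: "snd i < b (fst i)"
      using comp_vec_in_free_mod[OF w(1)] by (simp add: free_mod_iff)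
    have "homogeneous (\<gamma> - fst i) (Poly_Mapping.lookup ?w i)"
      by (simp add: lookup_comp_vec)
    note * = scale_homogeneous_cases[OF subspace_cover cover_basis[OF i] this, unfolded prod.collapse]
    show "scale_vec (Poly_Mapping.lookup ?w i) (d (Poly_Mapping.single i 1)) \<in> kv.span ?S"
    proof (cases "fst i = \<gamma>")
      case True
      then have "d (Poly_Mapping.single i 1) \<in> ?S"
        using i by (cases i) auto
      then have "kscale c (d (Poly_Mapping.single i 1)) \<in> kv.span ?S" for c
        by (intro kv.span_scale kv.span_base)
      then show ?thesis
        using * unfolding if_P[OF True] by simp
    next
      case False
      then show ?thesis
        using * kv.span_mono[of "mpart M \<gamma>" ?S] by auto
    qed
  qed
  finally show "u \<in> kv.span ?S" .
qed

text \<open>The images of the basis vectors of degree \<gamma> are independent modulo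
  \<open>mpart M \<gamma>\<close>: a relation would give a kernel element whose coordinate at
  \<open>(\<gamma>, n)\<close> has constant term 1, against minimality.\<close>

lemma cover_not_in_span:
  assumes n: "n < b \<gamma>"
  shows "d (Poly_Mapping.single (\<gamma>, n) 1)
    \<notin> kv.span (mpart M \<gamma> \<union> (\<lambda>j. d (Poly_Mapping.single (\<gamma>, j) 1)) ` {..<n})"
proof
  \<comment> \<open>Its image contains the whole spanning set: multiples of variables have no
    constant terms, and the earlier basis vectors have theirs at indices below
    \<open>n\<close>.\<close>
  define W where "W = {w \<in> free_mod b. \<forall>i\<ge>n.
      Poly_Mapping.lookup (Poly_Mapping.lookup w (\<gamma>, i)) 0 = (0::'k)}"
  interpret dk: Vector_Spaces.linear kscale kscale d
    by (rule module_hom_kscale) (rule d.module_hom_axioms)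
  have "kv.subspace W"
    using subspace_vec_imp_kv[OF subspace_free_mod, of b, where 'b = 'k]
    by (intro kv.subspaceI) (simp_all add: W_def kv.subspace_0 kv.subspace_add kv.subspace_scale
        lookup_add lookup_kscale)
  then have "kv.subspace (d ` W)"
    by (rule dk.subspace_image)
  moreover have "mpart M \<gamma> \<subseteq> d ` W"
  proof
    fix u assume "u \<in> mpart M \<gamma>"
    then obtain v w where "w \<in> free_mod b" "u = scale_vec (var v) (d w)"
      using cover by (auto simp: mpart_def hpart_def minimal_cover_def)
    then have "scale_vec (var v) w \<in> W" "u = d (scale_vec (var v) w)"
      by (auto simp: W_def lookup_scale_vec d.scale vec.subspace_scale[OF subspace_free_mod])
    then show "u \<in> d ` W" by blast
  qed
  moreover have "d (Poly_Mapping.single (\<gamma>, j) 1) \<in> d ` W" if "j < n" for j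
    using that n by (intro imageI) (auto simp: W_def single_in_free_mod lookup_single)
  ultimately have *: "kv.span (mpart M \<gamma> \<union> (\<lambda>j. d (Poly_Mapping.single (\<gamma>, j) 1)) ` {..<n}) \<subseteq> d ` W"
    by (intro kv.span_minimal) auto
  assume "d (Poly_Mapping.single (\<gamma>, n) 1)
    \<in> kv.span (mpart M \<gamma> \<union> (\<lambda>j. d (Poly_Mapping.single (\<gamma>, j) 1)) ` {..<n})"
  then obtain w where w: "w \<in> W" "d (Poly_Mapping.single (\<gamma>, n) 1) = d w"
    using * by blast
  then have "Poly_Mapping.single (\<gamma>, n) 1 - w \<in> free_mod b"
    using n by (intro vec.subspace_diff subspace_free_mod single_in_free_mod) (auto simp: W_def)
  moreover have "d (Poly_Mapping.single (\<gamma>, n) 1 - w) = 0"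
    using w by (simp add: d.diff)
  ultimately have "Poly_Mapping.lookup (Poly_Mapping.lookup
      (Poly_Mapping.single (\<gamma>, n) 1 - w) (\<gamma>, n)) 0 = 0"
    using cover by (simp add: minimal_cover_def)
  then show False
    using w(1) by (simp add: W_def lookup_minus)
qed

text \<open>This recovers \<open>b \<gamma>\<close> from \<open>M\<close> alone and so makes the
  ranks unique. The spanning set \<open>A\<close> ensures that the bases involved are finite and
  their cardinalities add up.\<close>

lemma cover_dim:
  assumes fin: "finite A" "hpart M \<gamma> \<subseteq> kv.span A"
  shows "kv.dim (hpart M \<gamma>) = kv.dim (mpart M \<gamma>) + b \<gamma>"
proof -
  obtain B where B: "B \<subseteq> mpart M \<gamma>" "kv.independent B" "mpart M \<gamma> \<subseteq> kv.span B"
    "card B = kv.dim (mpart M \<gamma>)"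
    by (rule kv.basis_exists)
  have sub: "mpart M \<gamma> \<subseteq> hpart M \<gamma>"
    by (rule mpart_subset_hpart[OF subspace_cover])
  have "finite B"
    using kv.independent_span_bound[OF fin(1) B(2) order_trans[OF B(1) order_trans[OF sub fin(2)]]]
    by (rule conjunct1)
  let ?g = "\<lambda>j. d (Poly_Mapping.single (\<gamma>, j) 1)"
  \<comment> \<open>The images of the basis vectors are adjoined one at a time to a basis of the
    span of \<open>mpart M \<gamma>\<close>.\<close>
  have ind: "kv.independent (B \<union> ?g ` {..<n}) \<and> card (B \<union> ?g ` {..<n}) = card B + n" if "n \<le> b \<gamma>" for n
    using that
  proof (induction n)
    case (Suc n)
    have "?g n \<notin> kv.span (B \<union> ?g ` {..<n})"
      using cover_not_in_span[of n \<gamma>] Suc.prems kv.span_mono[OF Un_mono[OF B(1) subset_refl]]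
      by (simp add: Suc_le_eq) blast
    moreover from this have "?g n \<notin> B \<union> ?g ` {..<n}"
      by (rule contrapos_nn) (rule kv.span_base)
    ultimately show ?case
      using Suc.IH Suc.prems \<open>finite B\<close> by (simp add: lessThan_Suc kv.independent_insertI)
  qed (use B in simp)
  let ?B = "B \<union> ?g ` {..<b \<gamma>}"
  have "?B \<subseteq> hpart M \<gamma>"
    using B(1) sub cover_basis by blast
  moreover have "hpart M \<gamma> \<subseteq> kv.span ?B"
  proof (rule order_trans[OF cover_span])
    have "mpart M \<gamma> \<subseteq> kv.span ?B"
      using B(3) kv.span_mono[of B ?B] by blast
    moreover have "?g ` {..<b \<gamma>} \<subseteq> kv.span ?B"
      using kv.span_superset[of ?B] by blast
    ultimately show "kv.span (mpart M \<gamma> \<union> ?g ` {..<b \<gamma>}) \<subseteq> kv.span ?B"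
      by (intro kv.span_minimal) auto
  qed
  ultimately show ?thesis
    using ind[of "b \<gamma>"] kv.basis_card_eq_dim[of ?B "hpart M \<gamma>"] B(4) by simp
qed

end

lemma finite_mdeg_interval: "finite {\<alpha> :: 'v::finite mdeg. 0 \<le> \<alpha> \<and> \<alpha> \<le> \<gamma>}"
proof (rule finite_subset)
  show "{\<alpha>. 0 \<le> \<alpha> \<and> \<alpha> \<le> \<gamma>} \<subseteq> Pi\<^sub>E UNIV (\<lambda>v. {0..\<gamma> v})"
    by (auto simp: le_fun_def)
qed (simp add: finite_PiE)

text \<open>Only basis vectors of degree between 0 and \<gamma> contribute, which leaves finitely
  many, and each contributes the multiples of a single monomial.\<close>

lemma hpart_free_mod_span:
  fixes b :: "'v::finite mdeg \<Rightarrow> nat"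
  assumes "\<And>\<alpha>. b \<alpha> \<noteq> 0 \<Longrightarrow> 0 \<le> \<alpha>"
  obtains A :: "('v, 'k::field) free_vec set"
  where "finite A" "hpart (free_mod b) \<gamma> \<subseteq> kv.span A"
proof
  let ?I = "Sigma {\<alpha>. 0 \<le> \<alpha> \<and> \<alpha> \<le> \<gamma>} (\<lambda>\<alpha>. {..<b \<alpha>})"
  let ?g = "\<lambda>i. Poly_Mapping.single i (Poly_Mapping.single (deg_mono (\<gamma> - fst i)) 1) :: ('v, 'k) free_vec"
  show "finite (?g ` ?I)"
    using finite_mdeg_interval by (intro finite_imageI finite_SigmaI) auto
  show "hpart (free_mod b) \<gamma> \<subseteq> kv.span (?g ` ?I)"
  proof
    fix u :: "('v, 'k) free_vec" assume u: "u \<in> hpart (free_mod b) \<gamma>"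
    have "(\<Sum>i\<in>Poly_Mapping.keys u. scale_vec (Poly_Mapping.lookup u i) (Poly_Mapping.single i 1))
        \<in> kv.span (?g ` ?I)"
    proof (rule kv.span_sum)
      fix i assume i: "i \<in> Poly_Mapping.keys u"
      then have "Poly_Mapping.lookup u i \<noteq> 0" "homogeneous (\<gamma> - fst i) (Poly_Mapping.lookup u i)"
        using u unfolding in_keys_iff hpart_def homogeneous_vec_iff by blast+
      then obtain t c where t: "mono_deg t = \<gamma> - fst i" "Poly_Mapping.lookup u i = Poly_Mapping.single t c"
        using homogeneous_cases by blast
      have 1: "snd i < b (fst i)"
        using u i by (simp add: hpart_def free_mod_iff)
      moreover have "0 \<le> \<gamma> - fst i"
        unfolding t(1)[symmetric] by simp
      ultimately have "i \<in> ?I"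
        using assms[of "fst i"] by (cases i) auto
      then have "?g i \<in> kv.span (?g ` ?I)"
        by (intro kv.span_base imageI)
      moreover have "t = deg_mono (\<gamma> - fst i)"
        unfolding t(1)[symmetric] by simp
      ultimately show "scale_vec (Poly_Mapping.lookup u i) (Poly_Mapping.single i 1) \<in> kv.span (?g ` ?I)"
        using kv.span_scale[of "?g i" "?g ` ?I" c]
        by (simp add: t(2) kscale_def mult_single)
    qed
    then show "u \<in> kv.span (?g ` ?I)"
      using vec_expansion[of u] by simp
  qed
qed

subsection \<open>Existence of minimal covers and resolutions\<close>

definition lin_ext :: "('v mdeg \<times> nat \<Rightarrow> ('v, 'k::field) free_vec) \<Rightarrow> ('v, 'k) free_vec \<Rightarrow> ('v, 'k) free_vec" where
  "lin_ext G u = (\<Sum>i\<in>Poly_Mapping.keys u. scale_vec (Poly_Mapping.lookup u i) (G i))"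

lemma lin_ext_superset:
  assumes "finite A" "Poly_Mapping.keys u \<subseteq> A"
  shows "lin_ext G u = (\<Sum>i\<in>A. scale_vec (Poly_Mapping.lookup u i) (G i))"
  unfolding lin_ext_def using assms by (intro sum.mono_neutral_left) (auto simp: in_keys_iff)

lemma module_hom_lin_ext: "module_hom scale_vec scale_vec (lin_ext G)"
proof
  fix u w :: "('a, 'b) free_vec" and r
  let ?A = "Poly_Mapping.keys u \<union> Poly_Mapping.keys w"
  show "lin_ext G (u + w) = lin_ext G u + lin_ext G w"
    using keys_add[of u w]
    by (simp add: lin_ext_superset[of ?A] lookup_add vec.scale_left_distrib sum.distrib)
  show "lin_ext G (scale_vec r u) = scale_vec r (lin_ext G u)"
    using keys_scale_vec[of r u]
    by (simp add: lin_ext_superset[of "Poly_Mapping.keys u"] lookup_scale_vec vec.scale_sum_right)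
qed

lemma lin_ext_basis: "lin_ext G (Poly_Mapping.single i 1) = G i"
  by (simp add: lin_ext_def)

lemma homogeneous_vec_nonneg:
  assumes "u \<in> hpart (free_mod b) \<gamma>" "u \<noteq> 0" and b: "\<And>\<alpha>. b \<alpha> \<noteq> 0 \<Longrightarrow> 0 \<le> \<alpha>"
  shows "0 \<le> \<gamma>"
proof -
  obtain i where i: "Poly_Mapping.lookup u i \<noteq> 0"
    using assms(2) by (metis lookup_zero poly_mapping_eqI)
  have "snd i < b (fst i)"
    using free_mod_lookup[OF _ i] assms(1) unfolding hpart_def by blast
  then have "0 \<le> fst i"
    using b[of "fst i"] by linarith
  moreover have "homogeneous (\<gamma> - fst i) (Poly_Mapping.lookup u i)"
    using assms(1) unfolding hpart_def homogeneous_vec_iff by blast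
  then have "0 \<le> \<gamma> - fst i"
    using i homogeneous_nonneg by blast
  ultimately show ?thesis
    by (metis add_increasing diff_add_cancel)
qed

text \<open>The set \<open>C\<close> completes a basis \<open>B\<close> of the span of
  \<open>mpart M \<gamma>\<close> to one of \<open>hpart M \<gamma>\<close>: these are the minimal
  generators in degree \<gamma>.\<close>

lemma degree_complement:
  assumes sub: "vec.subspace M" and A: "finite A" "hpart M \<gamma> \<subseteq> kv.span A"
  shows "\<exists>B C. finite C \<and> B \<subseteq> mpart M \<gamma> \<and> mpart M \<gamma> \<subseteq> kv.span B \<and> B \<inter> C = {} \<and>
    kv.independent (B \<union> C) \<and> C \<subseteq> hpart M \<gamma> \<and> hpart M \<gamma> \<subseteq> kv.span (B \<union> C)"
proof -
  obtain B where B: "B \<subseteq> mpart M \<gamma>" "kv.independent B" "mpart M \<gamma> \<subseteq> kv.span B"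
    by (rule kv.maximal_independent_subset)
  obtain B' where B': "B \<subseteq> B'" "B' \<subseteq> hpart M \<gamma>" "kv.independent B'" "hpart M \<gamma> \<subseteq> kv.span B'"
    by (rule kv.maximal_independent_subset_extend[OF order_trans[OF B(1) mpart_subset_hpart[OF sub]] B(2)])
  have "finite B'"
    using kv.independent_span_bound[OF A(1) B'(3) order_trans[OF B'(2) A(2)]] by (rule conjunct1)
  moreover have "B \<union> (B' - B) = B'"
    using B'(1) by blast
  ultimately show ?thesis
    using B B' by (intro exI[of _ B] exI[of _ "B' - B"]) auto
qed

text \<open>The generators are complements of the span of \<open>mpart M \<gamma>\<close>, chosen
  degree by degree. The new ranks again vanish outside degrees \<ge> 0, so the construction can be
  repeated on the kernel.\<close>

lemma exists_minimal_cover: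
  fixes b :: "'v::finite mdeg \<Rightarrow> nat" and M :: "('v, 'k::field) free_vec set"
  assumes b: "\<And>\<alpha>. b \<alpha> \<noteq> 0 \<Longrightarrow> 0 \<le> \<alpha>" and M: "M \<subseteq> free_mod b" "graded_submodule M"
  obtains b' d where "\<And>\<alpha>. b' \<alpha> \<noteq> 0 \<Longrightarrow> 0 \<le> \<alpha>" "minimal_cover b' d M"
proof -
  have sub: "vec.subspace M"
    using M(2) by (simp add: graded_submodule_def)
  define P where "P \<gamma> B C \<longleftrightarrow> finite C \<and> B \<subseteq> mpart M \<gamma> \<and> mpart M \<gamma> \<subseteq> kv.span B \<and> B \<inter> C = {} \<and>
    kv.independent (B \<union> C) \<and> C \<subseteq> hpart M \<gamma> \<and> hpart M \<gamma> \<subseteq> kv.span (B \<union> C)" for \<gamma> B C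
  have "\<exists>B C. P \<gamma> B C" for \<gamma>
  proof -
    obtain A :: "('v, 'k) free_vec set" where "finite A" "hpart (free_mod b) \<gamma> \<subseteq> kv.span A"
      using hpart_free_mod_span[OF b] by blast
    moreover have "hpart M \<gamma> \<subseteq> hpart (free_mod b) \<gamma>"
      using M(1) by (auto simp: hpart_def)
    ultimately show ?thesis
      unfolding P_def by (intro degree_complement[OF sub]) auto
  qed
  then obtain B C where P: "\<And>\<gamma>. P \<gamma> (B \<gamma>) (C \<gamma>)"
    by metis
  have BC: "\<And>\<gamma>. finite (C \<gamma>)" "\<And>\<gamma>. B \<gamma> \<subseteq> mpart M \<gamma>" "\<And>\<gamma>. mpart M \<gamma> \<subseteq> kv.span (B \<gamma>)"
    "\<And>\<gamma>. B \<gamma> \<inter> C \<gamma> = {}" "\<And>\<gamma>. kv.independent (B \<gamma> \<union> C \<gamma>)" "\<And>\<gamma>. C \<gamma> \<subseteq> hpart M \<gamma>"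
    "\<And>\<gamma>. hpart M \<gamma> \<subseteq> kv.span (B \<gamma> \<union> C \<gamma>)"
    using P unfolding P_def by auto
  define b' where "b' \<gamma> = card (C \<gamma>)" for \<gamma>
  have "\<exists>g. bij_betw g {0..<b' \<gamma>} (C \<gamma>)" for \<gamma>
    unfolding b'_def by (rule ex_bij_betw_nat_finite) (rule BC)
  then obtain g where g: "\<And>\<gamma>. bij_betw (g \<gamma>) {0..<b' \<gamma>} (C \<gamma>)"
    by metis
  \<comment> \<open>The value 0 outside the index range keeps \<open>G i\<close> in
    \<open>hpart M (fst i)\<close> for every index, so \<open>d\<close> maps the whole ambient type
    into \<open>M\<close>.\<close>
  define G where "G i = (if snd i < b' (fst i) then g (fst i) (snd i) else 0)" for i
  have G_C: "G i \<in> C (fst i)" if "snd i < b' (fst i)" for i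
    using that g[of "fst i"] by (auto simp: G_def bij_betw_def)
  have G_M: "G i \<in> hpart M (fst i)" for i
    using G_C[of i] BC(6)[of "fst i"] kv.subspace_0[OF subspace_hpart[OF sub]]
    by (cases "snd i < b' (fst i)") (auto simp: G_def)
  define d where "d = lin_ext G"
  interpret d: module_hom scale_vec scale_vec d
    unfolding d_def by (rule module_hom_lin_ext)
  have d_basis: "d (Poly_Mapping.single i 1) = G i" for i
    by (simp add: d_def lin_ext_basis)
  have d_M: "d u \<in> M" for u
    unfolding d_def lin_ext_def using G_M
    by (intro vec.subspace_sum[OF sub] vec.subspace_scale[OF sub]) (auto simp: hpart_def)
  have d_hom: "homogeneous_vec \<gamma> (d u)" if "homogeneous_vec \<gamma> u" for \<gamma> u
  proof -
    have "scale_vec (Poly_Mapping.lookup u i) (G i) \<in> hpart M \<gamma>" for i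
    proof -
      have "homogeneous (\<gamma> - fst i) (Poly_Mapping.lookup u i)"
        using that unfolding homogeneous_vec_iff by blast
      then have "homogeneous_vec (\<gamma> - fst i + fst i) (scale_vec (Poly_Mapping.lookup u i) (G i))"
        using G_M[of i] by (intro homogeneous_vec_scale) (auto simp: hpart_def)
      then show ?thesis
        using G_M[of i] vec.subspace_scale[OF sub] by (simp add: hpart_def)
    qed
    then have "d u \<in> hpart M \<gamma>"
      unfolding d_def lin_ext_def by (intro kv.subspace_sum subspace_hpart sub)
    then show ?thesis
      by (simp add: hpart_def)
  qed
  define D where "D = d ` free_mod b'"
  have D: "vec.subspace D"
    unfolding D_def by (intro d.subspace_image subspace_free_mod)
  \<comment> \<open>A graded Nakayama argument by induction on the total degree. Dividing by a
    variable lowers it by one, and \<open>nat\<close> loses nothing because a nonzero vector has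
    degree \<ge> 0.\<close>
  have "hpart M \<gamma> \<subseteq> D" for \<gamma>
  proof (induction "nat (\<Sum>v\<in>UNIV. \<gamma> v)" arbitrary: \<gamma> rule: less_induct)
    case less
    have "C \<gamma> \<subseteq> D"
    proof
      fix x assume "x \<in> C \<gamma>"
      then obtain j where "j \<in> {0..<b' \<gamma>}" "x = g \<gamma> j"
        using bij_betw_imp_surj_on[OF g[of \<gamma>]] by blast
      then have "x = d (Poly_Mapping.single (\<gamma>, j) 1)" "j < b' \<gamma>"
        by (auto simp: d_basis G_def)
      then show "x \<in> D"
        unfolding D_def using single_in_free_mod by blast
    qed
    moreover have "mpart M \<gamma> \<subseteq> D"
    proof
      fix x assume "x \<in> mpart M \<gamma>"
      then obtain v u where u: "u \<in> hpart M (\<gamma> - unit_deg v)" "x = scale_vec (var v) u"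
        by (auto simp: mpart_def)
      have "u \<in> D"
      proof (cases "u = 0")
        case True
        then show ?thesis using vec.subspace_0[OF D] by simp
      next
        case False
        have "0 \<le> \<gamma> - unit_deg v"
          by (rule homogeneous_vec_nonneg[OF _ False b, of b]) (use u(1) M(1) in \<open>auto simp: hpart_def\<close>)
        then have "0 \<le> (\<Sum>w\<in>UNIV. (\<gamma> - unit_deg v) w)"
          by (intro sum_nonneg) (simp add: le_fun_def)
        moreover have "(\<Sum>w\<in>UNIV. (\<gamma> - unit_deg v) w) = (\<Sum>w\<in>UNIV. \<gamma> w) - 1"
          by (simp add: sum_subtractf unit_deg_def of_bool_def)
        ultimately have "nat (\<Sum>w\<in>UNIV. (\<gamma> - unit_deg v) w) < nat (\<Sum>w\<in>UNIV. \<gamma> w)"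
          by linarith
        then show ?thesis
          using less u(1) by blast
      qed
      then show "x \<in> D"
        using u(2) vec.subspace_scale[OF D] by simp
    qed
    ultimately have "kv.span (B \<gamma> \<union> C \<gamma>) \<subseteq> D"
      using BC(2)[of \<gamma>] by (intro kv.span_minimal subspace_vec_imp_kv D) auto
    then show ?case
      using BC(7)[of \<gamma>] by blast
  qed
  then have "M \<subseteq> D"
  proof (intro subsetI)
    fix u assume "u \<in> M" "\<And>\<gamma>. hpart M \<gamma> \<subseteq> D"
    then have "comp_vec \<gamma> u \<in> hpart M \<gamma>" for \<gamma>
      using M(2) by (simp add: hpart_def graded_submodule_def)
    then have "comp_vec \<gamma> u \<in> D" for \<gamma>
      using \<open>\<And>\<gamma>. hpart M \<gamma> \<subseteq> D\<close> by blast
    moreover obtain S where "finite S" "u = (\<Sum>\<gamma>\<in>S. comp_vec \<gamma> u)"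
      by (rule comp_vec_decomposition)
    ultimately show "u \<in> D"
      by (metis vec.subspace_sum[OF D])
  qed
  then have d_image: "d ` free_mod b' = M"
    using d_M unfolding D_def by blast
  \<comment> \<open>In degree \<open>fst i\<close>, a nonzero constant term at \<open>i\<close>
    would express \<open>G i\<close> through the other members of the independent set
    \<open>B (fst i) \<union> C (fst i)\<close>.\<close>
  have ker: "Poly_Mapping.lookup (Poly_Mapping.lookup u i) 0 = 0" if u: "u \<in> free_mod b'" "d u = 0" for u i
  proof (rule ccontr)
    assume c: "Poly_Mapping.lookup (Poly_Mapping.lookup u i) 0 \<noteq> 0" (is "?c \<noteq> 0")
    let ?\<gamma> = "fst i"
    let ?w = "comp_vec ?\<gamma> u"
    let ?t = "\<lambda>i. scale_vec (Poly_Mapping.lookup ?w i) (G i)"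
    have i: "snd i < b' ?\<gamma>"
      by (rule free_mod_lookup[OF u(1)]) (metis c lookup_zero)
    have hom: "homogeneous (?\<gamma> - fst k) (Poly_Mapping.lookup ?w k)" for k
      by (simp add: lookup_comp_vec)
    have wi: "Poly_Mapping.lookup (Poly_Mapping.lookup ?w i) 0 = ?c"
      by (simp add: lookup_comp_vec lookup_hcomp)
    then have i_keys: "i \<in> Poly_Mapping.keys ?w"
      using c by (auto simp: in_keys_iff)
    have "d ?w = comp_vec ?\<gamma> (d u)"
      by (rule comp_vec_module_hom[symmetric, OF d.module_hom_axioms d_hom u(1)])
    then have "(\<Sum>k\<in>Poly_Mapping.keys ?w. ?t k) = 0"
      using u(2) by (simp add: d_def lin_ext_def)
    then have sum0: "?t i + (\<Sum>k\<in>Poly_Mapping.keys ?w - {i}. ?t k) = 0"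
      using i_keys by (simp add: sum.remove)
    let ?S = "B ?\<gamma> \<union> C ?\<gamma> - {G i}"
    have rest: "(\<Sum>k\<in>Poly_Mapping.keys ?w - {i}. ?t k) \<in> kv.span ?S"
    proof (rule kv.span_sum)
      fix k assume k: "k \<in> Poly_Mapping.keys ?w - {i}"
      then have kb: "snd k < b' (fst k)"
        using comp_vec_in_free_mod[OF u(1)] by (auto simp: free_mod_iff)
      note * = scale_homogeneous_cases[OF sub G_M[of k] hom[of k]]
      show "?t k \<in> kv.span ?S"
      proof (cases "fst k = ?\<gamma>")
        case True
        then have "snd k \<noteq> snd i"
          using k by (auto simp: prod_eq_iff)
        then have "g ?\<gamma> (snd k) \<noteq> g ?\<gamma> (snd i)"
          using kb i g[of ?\<gamma>] True by (auto simp: bij_betw_def inj_on_def)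
        then have "G k \<noteq> G i"
          using kb i True by (simp add: G_def)
        then have "G k \<in> ?S"
          using G_C[OF kb] True by auto
        then have "kscale c (G k) \<in> kv.span ?S" for c
          by (intro kv.span_scale kv.span_base)
        then show ?thesis
          using * unfolding if_P[OF True] by simp
      next
        case False
        \<comment> \<open>Removing \<open>G i\<close> costs nothing in \<open>B\<close>, since
          \<open>G i\<close> lies in the disjoint set \<open>C\<close>.\<close>
        have "B ?\<gamma> \<subseteq> ?S"
          using G_C[OF i] BC(4)[of ?\<gamma>] by blast
        then have "kv.span (mpart M ?\<gamma>) \<subseteq> kv.span ?S"
          using BC(3)[of ?\<gamma>] kv.span_mono[of "B ?\<gamma>" ?S] kv.span_minimal[of "mpart M ?\<gamma>" "kv.span ?S"]
          by auto
        then show ?thesis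
          using * unfolding if_not_P[OF False] by blast
      qed
    qed
    have "?t i = kscale ?c (G i)"
      using scale_homogeneous_cases[OF sub G_M[of i] hom[of i]] by (simp add: wi)
    moreover have "?t i = - (\<Sum>k\<in>Poly_Mapping.keys ?w - {i}. ?t k)"
      using sum0 by (simp only: eq_neg_iff_add_eq_0)
    ultimately have "kscale ?c (G i) \<in> kv.span ?S"
      using kv.span_neg[OF rest] by simp
    then have "kscale (inverse ?c) (kscale ?c (G i)) \<in> kv.span ?S"
      by (rule kv.span_scale)
    then have "G i \<in> kv.span ?S"
      using c by simp
    then show False
      using BC(5)[of ?\<gamma>] G_C[OF i] unfolding kv.dependent_def by blast
  qed
  have nonneg: "0 \<le> \<alpha>" if "b' \<alpha> \<noteq> 0" for \<alpha>
  proof -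
    have "C \<alpha> \<noteq> {}"
      using that by (auto simp: b'_def)
    then obtain x where x: "x \<in> C \<alpha>"
      by blast
    have "x \<noteq> 0"
      using x BC(5)[of \<alpha>] kv.dependent_zero by blast
    moreover have "x \<in> hpart (free_mod b) \<alpha>"
      using x BC(6) M(1) by (fastforce simp: hpart_def)
    ultimately show "0 \<le> \<alpha>"
      using homogeneous_vec_nonneg b by blast
  qed
  have "minimal_cover b' d M"
    unfolding minimal_cover_def using d.module_hom_axioms d_image d_hom ker by blast
  then show ?thesis
    using that nonneg by blast
qed

lemma cover_kernel:
  "minimal_cover b d M \<Longrightarrow> u \<in> free_mod b \<Longrightarrow> d u = 0 \<Longrightarrow>
    Poly_Mapping.lookup (Poly_Mapping.lookup u i) 0 = 0"
  by (simp add: minimal_cover_def del: split_paired_All)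

lemma graded_kernel:
  assumes "minimal_cover b d M"
  shows "graded_submodule {u \<in> free_mod b. d u = 0}"
proof -
  interpret d: module_hom scale_vec scale_vec d
    using assms by (simp add: minimal_cover_def)
  have "comp_vec \<gamma> u \<in> {u \<in> free_mod b. d u = 0}" if "u \<in> free_mod b" "d u = 0" for u \<gamma>
  proof -
    have "d (comp_vec \<gamma> u) = comp_vec \<gamma> (d u)"
      using assms that(1)
      by (intro comp_vec_module_hom[symmetric, of d b]) (auto simp: minimal_cover_def)
    then show ?thesis
      using that by (simp add: comp_vec_in_free_mod)
  qed
  moreover have "{u \<in> free_mod b. d u = 0} = free_mod b \<inter> {u. d u = 0}"
    by blast
  then have "vec.subspace {u \<in> free_mod b. d u = 0}"
    using vec.subspace_inter[OF subspace_free_mod d.subspace_kernel] by simp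
  ultimately show ?thesis
    by (auto simp: graded_submodule_def)
qed

section \<open>Monomial ideals: the irrelevant ideal and edge ideals\<close>

interpretation poly: module "(*) :: ('v, 'k::field) mpoly \<Rightarrow> ('v, 'k) mpoly \<Rightarrow> ('v, 'k) mpoly"
  by unfold_locales (simp_all add: algebra_simps)

lemma monomial_expansion:
  "p = (\<Sum>t\<in>Poly_Mapping.keys p. Poly_Mapping.single t (Poly_Mapping.lookup p t))"
  by (rule poly_mapping_eqI) (auto simp: lookup_sum lookup_single when_def in_keys_iff)

text \<open>The right side is itself an ideal containing the generators; conversely, each term of
  one of its members is a multiple of a generator.\<close>

lemma monomial_ideal:
  "poly.span ((\<lambda>s. Poly_Mapping.single s 1) ` T)
    = {p :: ('v, 'k::field) mpoly. \<forall>t\<in>Poly_Mapping.keys p. \<exists>r. \<exists>s\<in>T. t = r + s}" (is "?L = ?R")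
proof (rule antisym)
  have "poly.subspace ?R"
  proof (rule poly.subspaceI)
    fix p q :: "('v, 'k) mpoly" assume "p \<in> ?R" "q \<in> ?R"
    then show "p + q \<in> ?R"
      using keys_add[of p q] by blast
  next
    fix p q :: "('v, 'k) mpoly" assume q: "q \<in> ?R"
    show "p * q \<in> ?R"
    proof safe
      fix t assume "t \<in> Poly_Mapping.keys (p * q)"
      then obtain a b where "t = a + b" "b \<in> Poly_Mapping.keys q"
        using keys_mult[of p q] by blast
      moreover from this(2) q obtain r s where "s \<in> T" "b = r + s"
        by blast
      ultimately have "t = (a + r) + s" "s \<in> T"
        by (simp_all add: add.assoc)
      then show "\<exists>r. \<exists>s\<in>T. t = r + s"
        by blast
    qed
  qed simp
  then show "?L \<subseteq> ?R"
    by (intro poly.span_minimal) (auto intro: exI[of _ 0])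
  show "?R \<subseteq> ?L"
  proof
    fix p assume p: "p \<in> ?R"
    have "(\<Sum>t\<in>Poly_Mapping.keys p. Poly_Mapping.single t (Poly_Mapping.lookup p t)) \<in> ?L"
    proof (rule poly.span_sum)
      fix t assume "t \<in> Poly_Mapping.keys p"
      then obtain r s where "s \<in> T" "t = r + s"
        using p by blast
      then have "Poly_Mapping.single t (Poly_Mapping.lookup p t)
          = Poly_Mapping.single r (Poly_Mapping.lookup p t) * Poly_Mapping.single s 1"
        by (simp add: mult_single)
      then show "Poly_Mapping.single t (Poly_Mapping.lookup p t) \<in> ?L"
        using poly.span_scale[OF poly.span_base[OF imageI[OF \<open>s \<in> T\<close>]]] by metis
    qed
    then show "p \<in> ?L"
      using monomial_expansion[of p] by simp
  qed
qed

text \<open>Every monomial other than 1 is divisible by a variable. This turns the minimality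
  condition of a resolution into the one on constant terms in \<open>minimal_cover\<close>.\<close>

lemma irrelevant_ideal_iff: "p \<in> irrelevant_ideal \<longleftrightarrow> Poly_Mapping.lookup p 0 = 0"
  for p :: "('v, 'k::field) mpoly"
proof -
  have *: "(\<exists>r. \<exists>s\<in>range (\<lambda>v. Poly_Mapping.single v 1). t = r + s) \<longleftrightarrow> t \<noteq> 0" for t :: "'v \<Rightarrow>\<^sub>0 nat"
  proof
    assume "t \<noteq> 0"
    then obtain v where "Poly_Mapping.lookup t v \<noteq> 0"
      by (metis poly_mapping_eqI lookup_zero)
    then have "t = (t - Poly_Mapping.single v 1) + Poly_Mapping.single v 1"
      by (intro poly_mapping_eqI) (auto simp: lookup_add lookup_minus lookup_single when_def)
    then show "\<exists>r. \<exists>s\<in>range (\<lambda>v. Poly_Mapping.single v 1). t = r + s"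
      by blast
  qed (use single_add_neq_0 add.commute in \<open>metis rangeE\<close>)
  have var: "range (var :: 'v \<Rightarrow> ('v, 'k) mpoly) = (\<lambda>s. Poly_Mapping.single s 1) ` range (\<lambda>v. Poly_Mapping.single v 1)"
    by (auto simp: var_def)
  then show ?thesis
    unfolding irrelevant_ideal_def var monomial_ideal * by (auto simp: in_keys_iff)
qed

text \<open>Being a set, it counts the two arcs of an edge once, just as they give one
  generator.\<close>

definition edge_degs :: "'v pair_pre_digraph \<Rightarrow> 'v mdeg set" where
  "edge_degs F = {unit_deg x + unit_deg y | x y. (x, y) \<in> parcs F}"

text \<open>Divisibility of monomials is the componentwise order on multidegrees.\<close>

lemma edge_ideal_iff:
  "p \<in> edge_ideal F \<longleftrightarrow> (\<forall>t\<in>Poly_Mapping.keys p. \<exists>\<alpha>\<in>edge_degs F. \<alpha> \<le> mono_deg t)"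
  for p :: "('v, 'k::field) mpoly"
proof -
  let ?T = "{Poly_Mapping.single x 1 + Poly_Mapping.single y 1 | x y. (x, y) \<in> parcs F}"
  have gens: "{var x * var y :: ('v, 'k) mpoly | x y. (x, y) \<in> parcs F} = (\<lambda>s. Poly_Mapping.single s 1) ` ?T"
    by (auto simp: var_def mult_single image_iff)
  have le: "(\<exists>r. \<exists>s\<in>?T. t = r + s) \<longleftrightarrow> (\<exists>\<alpha>\<in>edge_degs F. \<alpha> \<le> mono_deg t)" for t
  proof
    assume "\<exists>r. \<exists>s\<in>?T. t = r + s"
    then show "\<exists>\<alpha>\<in>edge_degs F. \<alpha> \<le> mono_deg t"
      unfolding edge_degs_def mono_deg_single[symmetric] mono_deg_simps(2)[symmetric]
      by (fastforce simp: mono_deg_simps(2) simp del: mono_deg_simps(4))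
  next
    assume "\<exists>\<alpha>\<in>edge_degs F. \<alpha> \<le> mono_deg t"
    then obtain x y where xy: "(x, y) \<in> parcs F"
      "mono_deg (Poly_Mapping.single x 1 + Poly_Mapping.single y 1) \<le> mono_deg t"
      unfolding edge_degs_def mono_deg_single[symmetric] mono_deg_simps(2)[symmetric] by blast
    let ?s = "Poly_Mapping.single x 1 + Poly_Mapping.single y (1::nat)"
    have "int (Poly_Mapping.lookup ?s k) \<le> int (Poly_Mapping.lookup t k)" for k
      using xy(2) unfolding mono_deg_def le_fun_def by blast
    then have "Poly_Mapping.lookup ?s k \<le> Poly_Mapping.lookup t k" for k
      by simp
    then have "t = (t - ?s) + ?s"
      by (intro poly_mapping_eqI) (simp only: lookup_add[of "t - ?s"] lookup_minus le_add_diff_inverse2)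
    then show "\<exists>r. \<exists>s\<in>?T. t = r + s"
      using xy(1) by blast
  qed
  show ?thesis
    unfolding edge_ideal_def gens monomial_ideal mem_Collect_eq le ..
qed

lemma hcomp_edge_ideal: "p \<in> edge_ideal F \<Longrightarrow> hcomp \<beta> p \<in> edge_ideal F"
  by (auto simp: edge_ideal_iff in_keys_iff lookup_hcomp when_def split: if_splits)

lemma subspace_edge_ideal: "poly.subspace (edge_ideal F)"
  unfolding edge_ideal_def by (rule poly.subspace_span)

lemma comp_vec_single:
  "comp_vec \<gamma> (Poly_Mapping.single i p) = Poly_Mapping.single i (hcomp (\<gamma> - fst i) p)"
  by (rule poly_mapping_eqI) (auto simp: lookup_comp_vec lookup_single when_def)

text \<open>Cover the ideal minimally, then its kernel, then the kernel of that cover, and so on, by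
  dependent choice.\<close>

lemma exists_minimal_free_resolution:
  fixes I :: "('v::finite, 'k::field) mpoly set"
  assumes sub: "poly.subspace I" and graded: "\<And>p \<beta>. p \<in> I \<Longrightarrow> hcomp \<beta> p \<in> I"
  shows "\<exists>b d e. minimal_free_resolution I b d e"
proof -
  \<comment> \<open>The ideal is placed in the free module on one basis vector of degree 0, so that
    the first step is an ordinary minimal cover too.\<close>
  define M0 :: "('v, 'k) free_vec set" where "M0 = Poly_Mapping.single (0, 0) ` I"
  \<comment> \<open>The invariant keeps ranks in degrees \<ge> 0 and each map a minimal cover, as
    the next choice requires; the clause for \<open>n = 0\<close> fixes the start.\<close>
  define P where "P n x \<longleftrightarrow> (\<forall>\<alpha>. fst x \<alpha> \<noteq> 0 \<longrightarrow> 0 \<le> \<alpha>) \<and> (\<exists>M. minimal_cover (fst x) (snd x) M) \<and>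
      (n = 0 \<longrightarrow> minimal_cover (fst x) (snd x) M0)"
    for n :: nat and x :: "('v mdeg \<Rightarrow> nat) \<times> (('v, 'k) free_vec \<Rightarrow> ('v, 'k) free_vec)"
  define Q where "Q n x y \<longleftrightarrow> minimal_cover (fst y) (snd y) {u \<in> free_mod (fst x). snd x u = 0}"
    for n :: nat and x y :: "('v mdeg \<Rightarrow> nat) \<times> (('v, 'k) free_vec \<Rightarrow> ('v, 'k) free_vec)"
  have "M0 \<subseteq> free_mod (\<lambda>\<alpha>. of_bool (\<alpha> = 0))"
    unfolding M0_def by (auto intro: single_in_free_mod)
  moreover have "graded_submodule M0"
  proof -
    have "vec.subspace M0"
    proof (rule vec.subspaceI)
      show "0 \<in> M0"
        unfolding M0_def using poly.subspace_0[OF sub] by (auto intro: image_eqI[of _ _ 0])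
    qed (use sub in \<open>auto simp: M0_def poly.subspace_add poly.subspace_scale simp flip: single_add\<close>)
    then show ?thesis
      using graded by (auto simp: graded_submodule_def M0_def comp_vec_single)
  qed
  ultimately obtain b d where "\<And>\<alpha>. b \<alpha> \<noteq> 0 \<Longrightarrow> 0 \<le> \<alpha>" "minimal_cover b d M0"
    by (rule exists_minimal_cover[rotated]) auto
  then have "P 0 (b, d)"
    by (auto simp: P_def)
  then have "\<exists>x. P 0 x" ..
  moreover have "\<exists>y. P (Suc n) y \<and> Q n x y" if "P n x" for n x
  proof -
    obtain b d where x: "x = (b, d)"
      by (cases x)
    have "\<exists>M. minimal_cover b d M" and b: "\<And>\<alpha>. b \<alpha> \<noteq> 0 \<Longrightarrow> 0 \<le> \<alpha>"
      using that by (auto simp: P_def x)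
    then have graded: "graded_submodule {u \<in> free_mod b. d u = 0}"
      using graded_kernel by blast
    obtain b' d' where "\<And>\<alpha>. b' \<alpha> \<noteq> 0 \<Longrightarrow> 0 \<le> \<alpha>" "minimal_cover b' d' {u \<in> free_mod b. d u = 0}"
      by (rule exists_minimal_cover[OF b _ graded]) auto
    then have "P (Suc n) (b', d')" "Q n x (b', d')"
      by (auto simp: P_def Q_def x)
    then show ?thesis
      by blast
  qed
  ultimately obtain f where f: "\<And>n. P n (f n)" "\<And>n. Q n (f n) (f (Suc n))"
    using dependent_nat_choice[of P Q] by blast
  define b where "b n = fst (f n)" for n
  define \<delta> where "\<delta> n = snd (f n)" for n
  define e where "e u = Poly_Mapping.lookup (\<delta> 0 u) (0, 0)" for u
  have cover0: "minimal_cover (b 0) (\<delta> 0) M0"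
    using f(1)[of 0] by (simp add: P_def b_def \<delta>_def)
  have cover: "minimal_cover (b (Suc n)) (\<delta> (Suc n)) {u \<in> free_mod (b n). \<delta> n u = 0}" for n
    using f(2)[of n] by (simp add: Q_def b_def \<delta>_def)
  interpret \<delta>: module_hom scale_vec scale_vec "\<delta> n" for n
    using cover0 cover by (cases n) (auto simp: minimal_cover_def)
  have \<delta>0: "\<delta> 0 u = Poly_Mapping.single (0, 0) (e u) \<and> e u \<in> I" if u: "u \<in> free_mod (b 0)" for u
  proof -
    have "\<delta> 0 u \<in> M0"
      using u cover0 by (auto simp: minimal_cover_def)
    then show ?thesis
      by (auto simp: M0_def e_def)
  qed
  have "module_hom scale_vec (*) e"
    unfolding e_def by unfold_locales (simp_all add: \<delta>.add \<delta>.scale lookup_add lookup_scale_vec)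
  moreover have "homogeneous \<gamma> (e u)" if "u \<in> free_mod (b 0)" "homogeneous_vec \<gamma> u" for u \<gamma>
  proof -
    have "homogeneous_vec \<gamma> (\<delta> 0 u)"
      using that cover0 by (auto simp: minimal_cover_def)
    then have "homogeneous (\<gamma> - fst (0, 0 :: nat)) (e u)"
      unfolding e_def homogeneous_vec_iff by blast
    then show ?thesis by simp
  qed
  moreover have "e ` free_mod (b 0) = I"
  proof
    show "e ` free_mod (b 0) \<subseteq> I"
      using \<delta>0 by blast
    show "I \<subseteq> e ` free_mod (b 0)"
    proof
      fix p assume "p \<in> I"
      then have "Poly_Mapping.single (0, 0) p \<in> \<delta> 0 ` free_mod (b 0)"
        using cover0 by (auto simp: minimal_cover_def M0_def)
      then obtain u where "u \<in> free_mod (b 0)" "\<delta> 0 u = Poly_Mapping.single (0, 0) p"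
        by (metis imageE)
      then have "p = e u" "u \<in> free_mod (b 0)"
        by (simp_all add: e_def)
      then show "p \<in> e ` free_mod (b 0)" by blast
    qed
  qed
  moreover have "{u \<in> free_mod (b 0). e u = 0} = \<delta> 1 ` free_mod (b 1)"
  proof -
    have "e u = 0 \<longleftrightarrow> \<delta> 0 u = 0" if "u \<in> free_mod (b 0)" for u
      using \<delta>0[OF that] by (metis lookup_single_eq lookup_zero single_zero)
    then have "{u \<in> free_mod (b 0). e u = 0} = {u \<in> free_mod (b 0). \<delta> 0 u = 0}"
      by blast
    then show ?thesis
      using cover[of 0] by (simp add: minimal_cover_def)
  qed
  moreover have "{u \<in> free_mod (b (Suc i)). \<delta> (Suc i) u = 0} = \<delta> (Suc (Suc i)) ` free_mod (b (Suc (Suc i)))" for i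
    using cover[of "Suc i"] by (simp add: minimal_cover_def)
  moreover have "\<delta> (Suc i) ` free_mod (b (Suc i)) \<subseteq> free_mod (b i)" for i
    using cover[of i] by (auto simp: minimal_cover_def)
  moreover have "homogeneous_vec \<gamma> (\<delta> (Suc i) u)" if "u \<in> free_mod (b (Suc i))" "homogeneous_vec \<gamma> u" for i u \<gamma>
    using cover[of i] that by (auto simp: minimal_cover_def)
  moreover have "Poly_Mapping.lookup (\<delta> (Suc i) u) c \<in> irrelevant_ideal" if "u \<in> free_mod (b (Suc i))" for i u c
  proof -
    \<comment> \<open>The image is the kernel of the previous cover, and that kernel has no constant
      terms.\<close>
    have "\<delta> (Suc i) u \<in> {u \<in> free_mod (b i). \<delta> i u = 0}"
      using cover[of i] that by (auto simp: minimal_cover_def)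
    moreover have "\<exists>M. minimal_cover (b i) (\<delta> i) M"
      using cover0 cover by (cases i) auto
    ultimately show ?thesis
      unfolding irrelevant_ideal_iff using cover_kernel by blast
  qed
  \<comment> \<open>The indices shift by one: \<open>\<delta> 0\<close> covers the copy
    \<open>M0\<close> of the ideal and becomes \<open>e\<close>, so the differentials start with
    \<open>\<delta> 1\<close>.\<close>
  ultimately have "minimal_free_resolution I b (\<lambda>i. \<delta> (Suc i)) e"
    unfolding minimal_free_resolution_def using \<delta>.module_hom_axioms by (simp add: subset_iff)
  then show ?thesis
    by blast
qed

subsection \<open>The first syzygies of an edge ideal\<close>

text \<open>The value at the point with all coordinates 1: a ring homomorphism to the field that is
  injective on every homogeneous component.\<close>

definition eval1 :: "('v, 'k::field) mpoly \<Rightarrow> 'k" where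
  "eval1 p = (\<Sum>t\<in>Poly_Mapping.keys p. Poly_Mapping.lookup p t)"

lemma eval1_add: "eval1 (p + q) = eval1 p + eval1 q"
  for p q :: "('v, 'k::field) mpoly"
proof -
  let ?A = "Poly_Mapping.keys p \<union> Poly_Mapping.keys q"
  have "eval1 r = (\<Sum>t\<in>?A. Poly_Mapping.lookup r t)" if "Poly_Mapping.keys r \<subseteq> ?A" for r :: "('v, 'k) mpoly"
    unfolding eval1_def using that by (intro sum.mono_neutral_left) (auto simp: in_keys_iff)
  then show ?thesis
    using keys_add[of p q] by (simp add: lookup_add sum.distrib)
qed

lemma eval1_single [simp]: "eval1 (Poly_Mapping.single t c) = c"
  by (simp add: eval1_def)

lemma eval1_0 [simp]: "eval1 0 = 0"
  by (simp add: eval1_def)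

lemma eval1_sum: "eval1 (sum f A) = (\<Sum>a\<in>A. eval1 (f a))"
  by (induction A rule: infinite_finite_induct) (simp_all add: eval1_add)

lemma eval1_mult: "eval1 (p * q) = eval1 p * eval1 q"
proof -
  have "p * q = (\<Sum>t\<in>Poly_Mapping.keys p. \<Sum>s\<in>Poly_Mapping.keys q.
      Poly_Mapping.single (t + s) (Poly_Mapping.lookup p t * Poly_Mapping.lookup q s))"
    by (subst monomial_expansion[of p], subst monomial_expansion[of q])
      (simp only: sum_product mult_single)
  then show ?thesis
    by (simp add: eval1_sum eval1_def[of p] eval1_def[of q] sum_product)
qed

lemma homogeneous_eval1_eq_0: "homogeneous \<beta> p \<Longrightarrow> eval1 p = 0 \<Longrightarrow> p = 0"
  by (metis eval1_single homogeneous_cases)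

definition fscale :: "'k::field \<Rightarrow> ('a \<Rightarrow> 'k) \<Rightarrow> 'a \<Rightarrow> 'k" where
  "fscale c f = (\<lambda>x. c * f x)"

interpretation fv: vector_space fscale
  by unfold_locales (auto simp: fscale_def fun_eq_iff algebra_simps)

text \<open>Weights on \<open>E\<close> are extended by 0 to the whole type, so that the spaces for
  different \<open>E\<close> can be compared and united as sets.\<close>

definition zero_sum :: "'a set \<Rightarrow> ('a \<Rightarrow> 'k::field) set" where
  "zero_sum E = {f. (\<forall>x. x \<notin> E \<longrightarrow> f x = 0) \<and> sum f E = 0}"

definition edge_degs_le :: "'v pair_pre_digraph \<Rightarrow> 'v mdeg \<Rightarrow> 'v mdeg set" where
  "edge_degs_le F \<gamma> = {\<alpha> \<in> edge_degs F. \<alpha> \<le> \<gamma>}"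

lemma finite_edge_degs [simp]: "finite (edge_degs (F :: 'v::finite pair_pre_digraph))"
proof -
  have "edge_degs F = (\<lambda>(x, y). unit_deg x + unit_deg y) ` parcs F"
    by (auto simp: edge_degs_def)
  then show ?thesis
    by simp
qed

lemma edge_degs_nonneg: "\<alpha> \<in> edge_degs F \<Longrightarrow> 0 \<le> \<alpha>"
  by (auto simp: edge_degs_def)

lemma sum_edge_deg: "\<alpha> \<in> edge_degs F \<Longrightarrow> (\<Sum>v\<in>UNIV. \<alpha> v) = (2::int)"
  for F :: "'v::finite pair_pre_digraph"
  by (auto simp: edge_degs_def sum.distrib unit_deg_def of_bool_def)

lemma mdeg_eqI_sum:
  fixes \<alpha> \<gamma> :: "'v::finite mdeg"
  assumes "\<alpha> \<le> \<gamma>" "sum \<alpha> UNIV = sum \<gamma> UNIV"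
  shows "\<alpha> = \<gamma>"
proof -
  have "(\<Sum>v\<in>UNIV. \<gamma> v - \<alpha> v) = 0"
    using assms(2) by (simp add: sum_subtractf)
  moreover have "0 \<le> \<gamma> v - \<alpha> v" for v
    using assms(1) by (simp add: le_fun_def)
  ultimately have "\<gamma> v - \<alpha> v = 0" for v
    by (subst (asm) sum_nonneg_eq_0_iff) auto
  then show ?thesis
    by (simp add: fun_eq_iff)
qed

lemma edge_degs_antichain:
  fixes F :: "'v::finite pair_pre_digraph"
  assumes "\<alpha> \<in> edge_degs F" "\<beta> \<in> edge_degs F" "\<alpha> \<le> \<beta>"
  shows "\<alpha> = \<beta>"
  using assms by (intro mdeg_eqI_sum) (simp_all add: sum_edge_deg)

text \<open>Stated for arbitrary sets because it is applied to \<open>mpart\<close>, a union of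
  subspaces; injectivity is therefore asked on the span.\<close>

lemma dim_image_inj_on:
  assumes T: "Vector_Spaces.linear kscale fscale T" and inj: "inj_on T (kv.span S)"
  shows "fv.dim (T ` S) = kv.dim S"
proof -
  interpret T: Vector_Spaces.linear kscale fscale T by fact
  obtain B where B: "B \<subseteq> S" "kv.independent B" "S \<subseteq> kv.span B" "card B = kv.dim S"
    by (rule kv.basis_exists)
  have sub: "kv.span B \<subseteq> kv.span S"
    by (rule kv.span_mono[OF B(1)])
  have "fv.independent (T ` B)"
    by (intro T.independent_injective_image B(2) inj_on_subset[OF inj sub])
  then have "card (T ` B) = fv.dim (T ` S)"
    using B T.span_image[of B] by (intro fv.basis_card_eq_dim) auto
  moreover have "card (T ` B) = card B"
    using kv.span_superset[of B] sub by (intro card_image inj_on_subset[OF inj]) auto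
  ultimately show ?thesis
    using B(4) by simp
qed

section \<open>Ranks of an arbitrary minimal resolution of an edge ideal in homological degrees 0
  and 1\<close>

context
  fixes F :: "'v::finite pair_pre_digraph" and b d
    and e :: "('v, 'k::field) free_vec \<Rightarrow> ('v, 'k) mpoly"
  assumes res: "minimal_free_resolution (edge_ideal F) b d e"
begin

interpretation e: module_hom scale_vec "(*)" e
  using res by (simp add: minimal_free_resolution_def)

lemma e_homogeneous: "u \<in> free_mod (b 0) \<Longrightarrow> homogeneous_vec \<gamma> u \<Longrightarrow> homogeneous \<gamma> (e u)"
  using res by (simp add: minimal_free_resolution_def)

lemma e_image: "e ` free_mod (b 0) = edge_ideal F"
  using res by (simp add: minimal_free_resolution_def)

lemma d_minimal:
  "w \<in> free_mod (b (Suc n)) \<Longrightarrow> Poly_Mapping.lookup (Poly_Mapping.lookup (d n w) i) 0 = 0"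
  using res by (simp add: minimal_free_resolution_def irrelevant_ideal_iff del: split_paired_All)

text \<open>By exactness the kernel of \<open>e\<close> is the image of \<open>d 0\<close>, whose
  coordinates lie in the irrelevant ideal.\<close>

lemma e_kernel:
  assumes "u \<in> free_mod (b 0)" "e u = 0"
  shows "Poly_Mapping.lookup (Poly_Mapping.lookup u i) 0 = 0"
proof -
  have "u \<in> d 0 ` free_mod (b 1)"
    using assms res unfolding minimal_free_resolution_def by blast
  then obtain w where "w \<in> free_mod (b (Suc 0))" "u = d 0 w"
    by auto
  then show ?thesis
    using d_minimal by blast
qed

lemma e_single: "e (Poly_Mapping.single i p) = p * e (Poly_Mapping.single i 1)"
  using e.scale[of p "Poly_Mapping.single i 1"] by simp

lemma e_basis:
  assumes "j < b 0 \<alpha>"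
  obtains t c where "mono_deg t = \<alpha>" "c \<noteq> 0" "e (Poly_Mapping.single (\<alpha>, j) 1) = Poly_Mapping.single t c"
proof -
  have "homogeneous \<alpha> (e (Poly_Mapping.single (\<alpha>, j) 1))"
    by (intro e_homogeneous single_in_free_mod assms homogeneous_vec_basis)
  moreover have "e (Poly_Mapping.single (\<alpha>, j) 1) \<noteq> 0"
    using e_kernel[OF single_in_free_mod[of j "b 0" \<alpha> 1, OF assms], of "(\<alpha>, j)"] by auto
  ultimately show ?thesis
    using that by (metis homogeneous_cases)
qed

text \<open>Basis vectors map to scaled monomials. If one of these divided another, the difference
  \<open>?u\<close> would be a kernel element with constant term 1 at
  \<open>(\<alpha>, j)\<close>.\<close>

lemma e_basis_antichain:
  assumes j: "j < b 0 \<alpha>" and j': "j' < b 0 \<alpha>'" and le: "\<alpha>' \<le> \<alpha>"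
  shows "(\<alpha>', j') = (\<alpha>, j)"
proof (rule ccontr)
  assume neq: "(\<alpha>', j') \<noteq> (\<alpha>, j)"
  obtain t c where t: "mono_deg t = \<alpha>" "c \<noteq> 0" "e (Poly_Mapping.single (\<alpha>, j) 1) = Poly_Mapping.single t c"
    using e_basis[OF j] by blast
  obtain t' c' where t': "mono_deg t' = \<alpha>'" "c' \<noteq> 0"
    "e (Poly_Mapping.single (\<alpha>', j') 1) = Poly_Mapping.single t' c'"
    using e_basis[OF j'] by blast
  have "Poly_Mapping.lookup t' v \<le> Poly_Mapping.lookup t v" for v
    using le t(1) t'(1) by (auto simp: mono_deg_def le_fun_def)
  then have tt: "t - t' + t' = t"
    by (intro poly_mapping_eqI) (simp add: lookup_add lookup_minus)
  let ?u = "Poly_Mapping.single (\<alpha>, j) 1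
    - Poly_Mapping.single (\<alpha>', j') (Poly_Mapping.single (t - t') (c / c'))"
  have "?u \<in> free_mod (b 0)"
    by (intro vec.subspace_diff subspace_free_mod single_in_free_mod j j')
  moreover have "e ?u = 0"
    unfolding e.diff e_single[of _ "Poly_Mapping.single (t - t') (c / c')"]
    using t'(2) by (simp add: t(3) t'(3) mult_single tt)
  ultimately have "Poly_Mapping.lookup (Poly_Mapping.lookup ?u (\<alpha>, j)) 0 = 0"
    by (rule e_kernel)
  then show False
    using neq by (simp add: lookup_minus lookup_single)
qed

text \<open>The edge monomial lies in the ideal, hence occurs in a multiple of the image of some
  basis vector; that image is a scaled monomial dividing it.\<close>

lemma basis_below_edge:
  assumes "\<alpha> \<in> edge_degs F"
  obtains \<delta> j where "j < b 0 \<delta>" "\<delta> \<le> \<alpha>"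
proof -
  have md: "mono_deg (deg_mono \<alpha>) = \<alpha>"
    using assms by (simp add: edge_degs_nonneg)
  have "Poly_Mapping.single (deg_mono \<alpha>) 1 \<in> edge_ideal F"
    using assms by (auto simp: edge_ideal_iff md)
  then obtain u where u: "u \<in> free_mod (b 0)" "e u = Poly_Mapping.single (deg_mono \<alpha>) 1"
    using e_image by (metis imageE)
  have "Poly_Mapping.lookup (e u) (deg_mono \<alpha>) \<noteq> 0"
    by (simp add: u(2))
  then have "(\<Sum>i\<in>Poly_Mapping.keys u. Poly_Mapping.lookup
      (Poly_Mapping.lookup u i * e (Poly_Mapping.single i 1)) (deg_mono \<alpha>)) \<noteq> 0"
    by (simp only: module_hom_expansion[OF e.module_hom_axioms, of u] lookup_sum not_False_eq_True)
  then obtain i where "i \<in> Poly_Mapping.keys u"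
    "Poly_Mapping.lookup (Poly_Mapping.lookup u i * e (Poly_Mapping.single i 1)) (deg_mono \<alpha>) \<noteq> 0"
    by (rule sum.not_neutral_contains_not_neutral)
  then obtain i where i: "i \<in> Poly_Mapping.keys u"
    "deg_mono \<alpha> \<in> Poly_Mapping.keys (Poly_Mapping.lookup u i * e (Poly_Mapping.single i 1))"
    unfolding in_keys_iff[of "deg_mono \<alpha>"] by blast
  have ib: "snd i < b 0 (fst i)"
    using i(1) u(1) by (simp add: free_mod_iff)
  obtain t c where t: "mono_deg t = fst i" "c \<noteq> 0" "e (Poly_Mapping.single i 1) = Poly_Mapping.single t c"
    using e_basis[OF ib] by auto
  obtain a where "deg_mono \<alpha> = a + t"
    using i(2) keys_mult[of "Poly_Mapping.lookup u i" "Poly_Mapping.single t c"] t(2)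
    unfolding t(3) by auto
  then have "\<alpha> = mono_deg a + fst i"
    using md t(1) by (metis mono_deg_simps(2))
  then have "fst i \<le> \<alpha>"
    by simp
  then show ?thesis
    using that ib by blast
qed

text \<open>Each basis degree lies above an edge degree and each edge degree above a basis degree.
  As both families are antichains, they coincide, with rank 1 throughout.\<close>

lemma b0: "b 0 \<alpha> = of_bool (\<alpha> \<in> edge_degs F)"
proof -
  have edge: "\<alpha> \<in> edge_degs F" if pos: "0 < b 0 \<alpha>" for \<alpha>
  proof -
    obtain t c where t: "mono_deg t = \<alpha>" "c \<noteq> 0" "e (Poly_Mapping.single (\<alpha>, 0) 1) = Poly_Mapping.single t c"
      using e_basis[OF pos] by blast
    have "e (Poly_Mapping.single (\<alpha>, 0) 1) \<in> edge_ideal F"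
      using e_image single_in_free_mod[of 0 "b 0" \<alpha>, OF pos] by blast
    then obtain \<epsilon> where \<epsilon>: "\<epsilon> \<in> edge_degs F" "\<epsilon> \<le> \<alpha>"
      using t by (auto simp: edge_ideal_iff)
    obtain \<delta> j where \<delta>: "j < b 0 \<delta>" "\<delta> \<le> \<epsilon>"
      using basis_below_edge[OF \<epsilon>(1)] by blast
    then have "\<delta> = \<alpha>"
      using e_basis_antichain[OF pos \<delta>(1)] \<epsilon>(2) by auto
    then show ?thesis
      using \<delta> \<epsilon> by auto
  qed
  show ?thesis
  proof (cases "\<alpha> \<in> edge_degs F")
    case True
    obtain \<delta> j where \<delta>: "j < b 0 \<delta>" "\<delta> \<le> \<alpha>"
      using basis_below_edge[OF True] by blast
    then have "0 < b 0 \<alpha>"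
      using edge_degs_antichain[OF edge True, of \<delta>] by auto
    moreover have "\<not> 1 < b 0 \<alpha>"
      using e_basis_antichain[of 0 \<alpha> 1 \<alpha>] by auto
    ultimately show ?thesis
      using True by simp
  qed (use edge in auto)
qed

definition syz where "syz = {u \<in> free_mod (b 0). e u = 0}"

text \<open>Exactness at the next module puts the kernel of \<open>d 0\<close> into the image of
  \<open>d 1\<close>, which is free of constant terms. Thus \<open>cover_dim\<close> computes
  \<open>b 1\<close>.\<close>

lemma cover_syz: "minimal_cover (b 1) (d 0) syz"
proof -
  have "Poly_Mapping.lookup (Poly_Mapping.lookup u i) 0 = 0"
    if "u \<in> free_mod (b 1)" "d 0 u = 0" for u i
  proof -
    have "u \<in> d (Suc 0) ` free_mod (b (Suc (Suc 0)))"
      using that res unfolding minimal_free_resolution_def One_nat_def by blast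
    then show ?thesis
      using d_minimal by blast
  qed
  then show ?thesis
    using res unfolding minimal_cover_def syz_def minimal_free_resolution_def by simp
qed

lemma subspace_syz: "vec.subspace syz"
  by (rule subspace_cover[OF cover_syz])

text \<open>In a fixed degree a vector of \<open>free_mod (b 0)\<close> is one scalar for each edge, extracted by
  evaluating at \<open>(1, \<dots>, 1)\<close>. The factor coming from \<open>e\<close> normalises the basis, so that the
  first syzygies become exactly the weights of sum zero.\<close>

definition weights :: "('v, 'k) free_vec \<Rightarrow> 'v mdeg \<Rightarrow> 'k" where
  "weights u = (\<lambda>\<alpha>. eval1 (Poly_Mapping.lookup u (\<alpha>, 0)) * eval1 (e (Poly_Mapping.single (\<alpha>, 0) 1)))"

lemma linear_weights: "Vector_Spaces.linear kscale fscale weights"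
proof unfold_locales
  fix u w :: "('v, 'k) free_vec" and c
  show "weights (u + w) = weights u + weights w"
    by (rule ext) (simp add: weights_def lookup_add eval1_add distrib_right)
  show "weights (kscale c u) = fscale c (weights u)"
    by (rule ext) (simp add: weights_def kscale_def fscale_def lookup_scale_vec eval1_mult mult.assoc)
qed

lemma eval1_basis: "\<alpha> \<in> edge_degs F \<Longrightarrow> eval1 (e (Poly_Mapping.single (\<alpha>, 0) 1)) \<noteq> 0"
proof -
  assume "\<alpha> \<in> edge_degs F"
  then obtain t c where "c \<noteq> 0" "e (Poly_Mapping.single (\<alpha>, 0) 1) = Poly_Mapping.single t c"
    by (metis b0 e_basis of_bool_eq(2) zero_less_one)
  then show ?thesis
    by simp
qed

lemma keys_free_mod: "u \<in> free_mod (b 0) \<Longrightarrow> Poly_Mapping.keys u \<subseteq> (\<lambda>\<alpha>. (\<alpha>, 0)) ` edge_degs F"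
proof
  fix i assume "u \<in> free_mod (b 0)" "i \<in> Poly_Mapping.keys u"
  then have "snd i < of_bool (fst i \<in> edge_degs F)"
    unfolding free_mod_iff b0 by blast
  then have "fst i \<in> edge_degs F" "i = (fst i, 0)"
    by (auto simp: of_bool_def prod_eq_iff split: if_splits)
  then show "i \<in> (\<lambda>\<alpha>. (\<alpha>, 0)) ` edge_degs F"
    by blast
qed

lemma eval1_e: "u \<in> free_mod (b 0) \<Longrightarrow> eval1 (e u) = sum (weights u) (edge_degs F)"
proof -
  assume u: "u \<in> free_mod (b 0)"
  let ?h = "\<lambda>i. eval1 (Poly_Mapping.lookup u i) * eval1 (e (Poly_Mapping.single i 1))"
  have "eval1 (e u) = sum ?h (Poly_Mapping.keys u)"
    by (subst module_hom_expansion[OF e.module_hom_axioms]) (simp add: eval1_sum eval1_mult)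
  also have "\<dots> = sum ?h ((\<lambda>\<alpha>. (\<alpha>, 0)) ` edge_degs F)"
    by (rule sum.mono_neutral_left) (use keys_free_mod[OF u] in \<open>auto simp: in_keys_iff\<close>)
  also have "\<dots> = sum (weights u) (edge_degs F)"
    by (subst sum.reindex) (auto simp: inj_on_def weights_def)
  finally show ?thesis .
qed

lemma weights_support:
  assumes "u \<in> hpart (free_mod (b 0)) \<gamma>" "\<alpha> \<notin> edge_degs_le F \<gamma>"
  shows "weights u \<alpha> = 0"
proof (cases "Poly_Mapping.lookup u (\<alpha>, 0) = 0")
  case False
  have "\<alpha> \<in> edge_degs F"
    using free_mod_lookup[OF _ False, of "b 0"] assms(1) by (auto simp: hpart_def b0)
  moreover have "homogeneous (\<gamma> - fst (\<alpha>, 0 :: nat)) (Poly_Mapping.lookup u (\<alpha>, 0))"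
    using assms(1) unfolding hpart_def homogeneous_vec_iff by blast
  then have "0 \<le> \<gamma> - fst (\<alpha>, 0 :: nat)"
    by (rule homogeneous_nonneg) (rule False)
  ultimately show ?thesis
    using assms(2) by (simp add: edge_degs_le_def)
qed (simp add: weights_def)

lemma sum_weights:
  assumes "u \<in> hpart (free_mod (b 0)) \<gamma>"
  shows "sum (weights u) (edge_degs_le F \<gamma>) = eval1 (e u)"
proof -
  have "sum (weights u) (edge_degs_le F \<gamma>) = sum (weights u) (edge_degs F)"
    using weights_support[OF assms] by (intro sum.mono_neutral_left) (auto simp: edge_degs_le_def)
  then show ?thesis
    using assms by (simp add: eval1_e hpart_def)
qed

text \<open>The sum of the weights is the value of \<open>e u\<close> at the all-ones point. Since
  \<open>e u\<close> is homogeneous, it vanishes exactly when that sum does.\<close>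

lemma weights_image: "weights ` hpart syz \<gamma> = zero_sum (edge_degs_le F \<gamma>)"
proof (intro antisym subsetI)
  fix f assume "f \<in> weights ` hpart syz \<gamma>"
  then obtain u where u: "f = weights u" "u \<in> hpart (free_mod (b 0)) \<gamma>" "e u = 0"
    by (auto simp: hpart_def syz_def)
  then show "f \<in> zero_sum (edge_degs_le F \<gamma>)"
    using weights_support[OF u(2)] sum_weights[OF u(2)] by (simp add: zero_sum_def)
next
  fix f :: "'v mdeg \<Rightarrow> 'k" assume f: "f \<in> zero_sum (edge_degs_le F \<gamma>)"
  define c where "c \<alpha> = f \<alpha> / eval1 (e (Poly_Mapping.single (\<alpha>, 0) 1))" for \<alpha>
  \<comment> \<open>The monomial lifts the basis vector at \<alpha> to degree \<gamma>, and the
    quotient in \<open>c\<close> cancels the normalising factor in \<open>weights\<close>.\<close>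
  define g where "g \<alpha> = Poly_Mapping.single (\<alpha>, 0 :: nat) (Poly_Mapping.single (deg_mono (\<gamma> - \<alpha>)) (c \<alpha>))" for \<alpha>
  define u where "u = sum g (edge_degs_le F \<gamma>)"
  have fin: "finite (edge_degs_le F \<gamma>)"
    by (simp add: edge_degs_le_def)
  have "g \<alpha> \<in> hpart (free_mod (b 0)) \<gamma>" if "\<alpha> \<in> edge_degs_le F \<gamma>" for \<alpha>
  proof -
    have "mono_deg (deg_mono (\<gamma> - \<alpha>)) = \<gamma> - \<alpha>"
      using that by (simp add: edge_degs_le_def)
    then have "homogeneous_vec (\<gamma> - \<alpha> + fst (\<alpha>, 0 :: nat)) (g \<alpha>)"
      unfolding g_def using homogeneous_single[of "deg_mono (\<gamma> - \<alpha>)" "c \<alpha>"]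
      by (intro homogeneous_vec_single) simp
    then show ?thesis
      using that by (simp add: hpart_def edge_degs_le_def g_def single_in_free_mod b0)
  qed
  then have u: "u \<in> hpart (free_mod (b 0)) \<gamma>"
    unfolding u_def by (intro kv.subspace_sum subspace_hpart subspace_free_mod)
  have "weights u \<alpha> = f \<alpha>" if "\<alpha> \<in> edge_degs_le F \<gamma>" for \<alpha>
  proof -
    have "Poly_Mapping.lookup u (\<alpha>, 0) = Poly_Mapping.single (deg_mono (\<gamma> - \<alpha>)) (c \<alpha>)"
      using that fin by (simp add: u_def g_def lookup_sum lookup_single when_def)
    then show ?thesis
      using that eval1_basis[of \<alpha>] by (simp add: weights_def c_def edge_degs_le_def)
  qed
  moreover have "weights u \<alpha> = f \<alpha>" if "\<alpha> \<notin> edge_degs_le F \<gamma>" for \<alpha>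
    using that f weights_support[OF u that] by (simp add: zero_sum_def)
  ultimately have fu: "weights u = f"
    by blast
  have "eval1 (e u) = 0"
    using sum_weights[OF u] f unfolding fu by (simp add: zero_sum_def)
  moreover have "homogeneous \<gamma> (e u)"
    using u e_homogeneous by (simp add: hpart_def)
  ultimately have "e u = 0"
    by (rule homogeneous_eval1_eq_0[rotated])
  then have "u \<in> hpart syz \<gamma>"
    using u by (simp add: hpart_def syz_def)
  then show "f \<in> weights ` hpart syz \<gamma>"
    using fu by blast
qed

lemma weights_eq_0:
  assumes u: "u \<in> hpart (free_mod (b 0)) \<gamma>" and "weights u = 0"
  shows "u = 0"
proof (rule poly_mapping_eqI)
  fix i
  show "Poly_Mapping.lookup u i = Poly_Mapping.lookup 0 i"
  proof (cases "i \<in> Poly_Mapping.keys u")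
    case True
    then obtain \<alpha> where i: "i = (\<alpha>, 0)" "\<alpha> \<in> edge_degs F"
      using u keys_free_mod[of u] by (auto simp: hpart_def)
    have "weights u \<alpha> = 0"
      using assms(2) by simp
    then have "eval1 (Poly_Mapping.lookup u i) = 0"
      using eval1_basis[OF i(2)] i(1) by (simp add: weights_def)
    moreover have "homogeneous (\<gamma> - fst i) (Poly_Mapping.lookup u i)"
      using u unfolding hpart_def homogeneous_vec_iff by blast
    ultimately show ?thesis
      using homogeneous_eval1_eq_0 by auto
  qed (simp add: in_keys_iff)
qed

lemma inj_on_weights: "inj_on weights (hpart syz \<gamma>)"
proof (rule inj_onI)
  fix u w assume *: "u \<in> hpart syz \<gamma>" "w \<in> hpart syz \<gamma>" "weights u = weights w"
  interpret T: Vector_Spaces.linear kscale fscale weights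
    by (rule linear_weights)
  have "u - w \<in> hpart syz \<gamma>"
    by (intro kv.subspace_diff subspace_hpart subspace_syz *)
  then have "u - w \<in> hpart (free_mod (b 0)) \<gamma>"
    by (simp add: hpart_def syz_def)
  then have "u - w = 0"
    by (rule weights_eq_0) (simp add: T.diff *)
  then show "u = w"
    by simp
qed

text \<open>A variable takes the value 1 at the all-ones point, so multiplying by it leaves the
  weights unchanged.\<close>

lemma weights_mpart: "weights ` mpart syz \<gamma> = (\<Union>v. zero_sum (edge_degs_le F (\<gamma> - unit_deg v)))"
proof -
  have "weights (scale_vec (var v) u) = weights u" for v u
    by (simp add: weights_def lookup_scale_vec eval1_mult var_def)
  then show ?thesis
    by (simp add: mpart_def image_UN image_image weights_image)
qed

text \<open>The dimension count of \<open>cover_dim\<close> for the first syzygies, carried over to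
  weights along an injective linear map.\<close>

lemma b1:
  "b 1 \<gamma> = fv.dim (zero_sum (edge_degs_le F \<gamma>) :: ('v mdeg \<Rightarrow> 'k) set)
    - fv.dim (\<Union>v. zero_sum (edge_degs_le F (\<gamma> - unit_deg v)) :: ('v mdeg \<Rightarrow> 'k) set)"
proof -
  obtain A :: "('v, 'k) free_vec set" where "finite A" "hpart (free_mod (b 0)) \<gamma> \<subseteq> kv.span A"
    by (rule hpart_free_mod_span[of "b 0" \<gamma>]) (auto simp: b0 edge_degs_nonneg)
  moreover have "hpart syz \<gamma> \<subseteq> hpart (free_mod (b 0)) \<gamma>"
    by (auto simp: hpart_def syz_def)
  ultimately have "kv.dim (hpart syz \<gamma>) = kv.dim (mpart syz \<gamma>) + b 1 \<gamma>"
    using cover_dim[OF cover_syz] by blast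
  moreover have "kv.span (hpart syz \<gamma>) = hpart syz \<gamma>"
    unfolding kv.span_eq_iff by (rule subspace_hpart[OF subspace_syz])
  then have "inj_on weights (kv.span (hpart syz \<gamma>))"
    using inj_on_weights by (simp only:)
  then have "fv.dim (weights ` hpart syz \<gamma>) = kv.dim (hpart syz \<gamma>)"
    by (intro dim_image_inj_on linear_weights)
  moreover have "fv.dim (weights ` mpart syz \<gamma>) = kv.dim (mpart syz \<gamma>)"
    by (intro dim_image_inj_on linear_weights
        inj_on_subset[OF inj_on_weights span_mpart_subset_hpart[OF subspace_syz]])
  ultimately show ?thesis
    by (simp add: weights_image weights_mpart)
qed

end

text \<open>The formula for \<open>b 1\<close> mentions only the graph, so it holds for every
  minimal resolution. With existence, this gives the definite description its value.\<close>

theorem graph_betti_1: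
  fixes F :: "'v::finite pair_pre_digraph"
  shows "graph_betti TYPE('k::field) 1 \<gamma> F
    = fv.dim (zero_sum (edge_degs_le F \<gamma>) :: ('v mdeg \<Rightarrow> 'k) set)
    - fv.dim (\<Union>v. zero_sum (edge_degs_le F (\<gamma> - unit_deg v)) :: ('v mdeg \<Rightarrow> 'k) set)"
  unfolding graph_betti_def betti_def
proof (rule the_equality)
  obtain b d e where "minimal_free_resolution (edge_ideal F :: ('v, 'k) mpoly set) b d e"
    using exists_minimal_free_resolution[OF subspace_edge_ideal hcomp_edge_ideal] by blast
  then show "\<exists>b d e. minimal_free_resolution (edge_ideal F :: ('v, 'k) mpoly set) b d e \<and> b 1 \<gamma>
    = fv.dim (zero_sum (edge_degs_le F \<gamma>) :: ('v mdeg \<Rightarrow> 'k) set)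
    - fv.dim (\<Union>v. zero_sum (edge_degs_le F (\<gamma> - unit_deg v)) :: ('v mdeg \<Rightarrow> 'k) set)"
    using b1 by blast
qed (use b1 in blast)

subsection \<open>Comparing graphs\<close>

lemma unit_deg_eq_iff [simp]: "unit_deg x = unit_deg y \<longleftrightarrow> x = y"
  by (auto simp: unit_deg_def fun_eq_iff)

section \<open>Dimensions of small spaces of zero-sum weights\<close>

lemma zero_sum_mono:
  assumes "E \<subseteq> E'" "finite E'"
  shows "zero_sum E \<subseteq> zero_sum E'"
proof
  fix f :: "'a \<Rightarrow> 'b" assume f: "f \<in> zero_sum E"
  have "sum f E = sum f E'"
    using f assms by (intro sum.mono_neutral_left) (auto simp: zero_sum_def)
  then show "f \<in> zero_sum E'"
    using f assms(1) by (auto simp: zero_sum_def)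
qed

lemma zero_sum_singleton: "zero_sum {x} = {0}"
  by (auto simp: zero_sum_def fun_eq_iff)

lemma dim_zero_sum_pair:
  assumes E: "E \<subseteq> {x, y}" and "x \<noteq> y"
  shows "fv.dim (zero_sum E :: ('a \<Rightarrow> 'k::field) set) \<le> 1"
proof -
  let ?g = "(\<lambda>a. of_bool (a = x) - of_bool (a = y)) :: 'a \<Rightarrow> 'k"
  have "zero_sum {x, y} \<subseteq> fv.span {?g}"
  proof
    fix f :: "'a \<Rightarrow> 'k" assume f: "f \<in> zero_sum {x, y}"
    then have "f y = - f x"
      using assms(2) by (simp add: zero_sum_def eq_neg_iff_add_eq_0 add.commute)
    moreover have "f a = 0" if "a \<noteq> x" "a \<noteq> y" for a
      using f that by (simp add: zero_sum_def)
    ultimately have "f a = fscale (f x) ?g a" for a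
      using assms(2) by (cases "a = x"; cases "a = y") (simp_all add: fscale_def)
    then have "f = fscale (f x) ?g"
      by (rule ext)
    then show "f \<in> fv.span {?g}"
      unfolding fv.span_singleton by (rule range_eqI)
  qed
  moreover have "(zero_sum E :: ('a \<Rightarrow> 'k) set) \<subseteq> zero_sum {x, y}"
    using E by (rule zero_sum_mono) simp
  ultimately have "(zero_sum E :: ('a \<Rightarrow> 'k) set) \<subseteq> fv.span {?g}"
    by (rule order_trans[rotated])
  then have "fv.dim (zero_sum E :: ('a \<Rightarrow> 'k) set) \<le> card {?g}"
    by (rule fv.dim_le_card) simp
  then show ?thesis
    by simp
qed

lemma dim_zero_sum_triple:
  assumes "x \<noteq> y" "x \<noteq> z" "y \<noteq> z"
  shows "fv.dim (zero_sum {x, y, z} :: ('a \<Rightarrow> 'k::field) set) = 2"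
proof -
  define g h :: "'a \<Rightarrow> 'k"
    where "g = (\<lambda>a. of_bool (a = x) - of_bool (a = z))" and "h = (\<lambda>a. of_bool (a = y) - of_bool (a = z))"
  have gh: "g x = 1" "g y = 0" "h x = 0" "h y = 1"
    using assms by (auto simp: g_def h_def)
  have "g \<notin> fv.span {h}"
  proof
    assume "g \<in> fv.span {h}"
    then obtain k where "g = fscale k h"
      by (auto simp: fv.span_singleton)
    then have "g x = fscale k h x"
      by (rule fun_cong)
    then show False
      using gh by (simp add: fscale_def)
  qed
  moreover have "h \<noteq> 0"
    using gh(4) by auto
  ultimately have ind: "fv.independent {g, h}"
    by (intro fv.independent_insertI fv.independent_empty) simp_all
  have "g \<noteq> h"
    using gh by auto
  then have card: "card {g, h} = 2"
    by simp
  have "zero_sum {x, y, z} \<subseteq> fv.span {g, h}"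
  proof
    fix f :: "'a \<Rightarrow> 'k" assume f: "f \<in> zero_sum {x, y, z}"
    then have "f x + (f y + f z) = 0"
      using assms by (simp add: zero_sum_def)
    then have "f z = - f x - f y"
      by (simp add: eq_neg_iff_add_eq_0 algebra_simps)
    moreover have "f a = 0" if "a \<noteq> x" "a \<noteq> y" "a \<noteq> z" for a
      using f that by (simp add: zero_sum_def)
    ultimately have "f a = (fscale (f x) g + fscale (f y) h) a" for a
      using assms by (cases "a = x"; cases "a = y"; cases "a = z") (simp_all add: fscale_def g_def h_def)
    then have "f = fscale (f x) g + fscale (f y) h"
      by (rule ext)
    then show "f \<in> fv.span {g, h}"
      by (rule ssubst) (intro fv.span_add fv.span_scale fv.span_base, simp_all)
  qed
  moreover have "{g, h} \<subseteq> zero_sum {x, y, z}"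
    using assms by (auto simp: zero_sum_def g_def h_def)
  ultimately show ?thesis
    using fv.basis_card_eq_dim[OF _ _ ind] card by simp
qed

text \<open>Here \<open>\<gamma> - unit_deg v\<close> has total degree 2, so at most one edge degree
  lies below it. A single edge carries no nonzero weight of sum zero, and the subtracted dimension
  vanishes.\<close>

lemma graph_betti_1_triangle:
  fixes F :: "'v::finite pair_pre_digraph"
  assumes "sum \<gamma> UNIV = 3"
  shows "graph_betti TYPE('k::field) 1 \<gamma> F = fv.dim (zero_sum (edge_degs_le F \<gamma>) :: ('v mdeg \<Rightarrow> 'k) set)"
proof -
  have "zero_sum (edge_degs_le F (\<gamma> - unit_deg v)) \<subseteq> ({0} :: ('v mdeg \<Rightarrow> 'k) set)" for v
  proof -
    have "\<alpha> = \<gamma> - unit_deg v" if "\<alpha> \<in> edge_degs F" "\<alpha> \<le> \<gamma> - unit_deg v" for \<alpha>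
    proof (rule mdeg_eqI_sum[OF that(2)])
      show "sum \<alpha> UNIV = sum (\<gamma> - unit_deg v) UNIV"
        using assms sum_edge_deg[OF that(1)] by (simp add: sum_subtractf unit_deg_def of_bool_def)
    qed
    then have "edge_degs_le F (\<gamma> - unit_deg v) \<subseteq> {\<gamma> - unit_deg v}"
      by (auto simp: edge_degs_le_def)
    then have "zero_sum (edge_degs_le F (\<gamma> - unit_deg v)) \<subseteq> (zero_sum {\<gamma> - unit_deg v} :: ('v mdeg \<Rightarrow> 'k) set)"
      by (rule zero_sum_mono) simp
    then show ?thesis
      by (simp only: zero_sum_singleton)
  qed
  then have "(\<Union>v. zero_sum (edge_degs_le F (\<gamma> - unit_deg v)) :: ('v mdeg \<Rightarrow> 'k) set) \<subseteq> fv.span {}"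
    by auto
  then have "fv.dim (\<Union>v. zero_sum (edge_degs_le F (\<gamma> - unit_deg v)) :: ('v mdeg \<Rightarrow> 'k) set) \<le> card ({} :: ('v mdeg \<Rightarrow> 'k) set)"
    by (rule fv.dim_le_card) simp
  then show ?thesis
    unfolding graph_betti_1 by simp
qed

lemma edge_degs_le_triangle:
  fixes F :: "'v pair_pre_digraph"
  assumes loopfree: "\<And>u. (u, u) \<notin> parcs F" and dist: "x \<noteq> y" "x \<noteq> z" "y \<noteq> z"
  shows "edge_degs_le F (unit_deg x + unit_deg y + unit_deg z)
    \<subseteq> {unit_deg x + unit_deg y, unit_deg y + unit_deg z, unit_deg x + unit_deg z}"
proof
  fix \<alpha> assume "\<alpha> \<in> edge_degs_le F (unit_deg x + unit_deg y + unit_deg z)"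
  then obtain p q where pq: "(p, q) \<in> parcs F" "\<alpha> = unit_deg p + unit_deg q"
    and le: "\<And>w. \<alpha> w \<le> unit_deg x w + unit_deg y w + unit_deg z w"
    by (auto simp: edge_degs_le_def edge_degs_def le_fun_def)
  have "p \<noteq> q"
    using pq(1) loopfree by auto
  moreover have "p \<in> {x, y, z}" "q \<in> {x, y, z}"
    using le[of p] le[of q] by (auto simp: pq(2) unit_deg_def of_bool_def split: if_splits)
  ultimately show "\<alpha> \<in> {unit_deg x + unit_deg y, unit_deg y + unit_deg z, unit_deg x + unit_deg z}"
    by (auto simp: pq(2) add.commute)
qed

lemma edge_degs_iff:
  assumes "sym (parcs F)" "x \<noteq> y"
  shows "unit_deg x + unit_deg y \<in> edge_degs F \<longleftrightarrow> (x, y) \<in> parcs F"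
proof
  assume "unit_deg x + unit_deg y \<in> edge_degs F"
  then obtain p q where pq: "(p, q) \<in> parcs F" "unit_deg x + unit_deg y = unit_deg p + unit_deg q"
    by (auto simp: edge_degs_def)
  have "unit_deg x w + unit_deg y w = unit_deg p w + unit_deg q w" for w
    using fun_cong[OF pq(2), of w] by simp
  from this[of x] this[of y] have "(x = p \<and> y = q) \<or> (x = q \<and> y = p)"
    using assms(2) by (auto simp: unit_deg_def of_bool_def split: if_splits)
  then show "(x, y) \<in> parcs F"
    using pq(1) assms(1) by (auto dest: symD)
qed (auto simp: edge_degs_def)

text \<open>In the degree of the triangle on \<open>x\<close>, \<open>y\<close>, \<open>z\<close>
  the graph \<open>H\<close> has three edges and hence Betti number 2; without the edge
  \<open>xy\<close>, at most two edges of \<open>G\<close> remain there, which allows at most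
  1.\<close>

lemma graph_betti_1_le_imp_arc:
  fixes G H :: "'v::finite pair_pre_digraph"
  assumes H: "parcs H = {(x, y). x \<in> S \<and> y \<in> S \<and> x \<noteq> y}"
    and G: "sym (parcs G)" "\<And>u. (u, u) \<notin> parcs G"
    and le: "\<And>\<gamma>. graph_betti TYPE('k::field) 1 \<gamma> H \<le> graph_betti TYPE('k) 1 \<gamma> G"
    and xyz: "x \<in> S" "y \<in> S" "z \<in> S" "x \<noteq> y" "x \<noteq> z" "y \<noteq> z"
  shows "(x, y) \<in> parcs G"
proof (rule ccontr)
  assume "(x, y) \<notin> parcs G"
  define a b c where "a = unit_deg x + unit_deg y" and "b = unit_deg y + unit_deg z"
    and "c = unit_deg x + unit_deg z"
  define \<gamma> where "\<gamma> = unit_deg x + unit_deg y + unit_deg z"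
  have dist: "a \<noteq> b" "a \<noteq> c" "b \<noteq> c"
    using xyz(4-6) by (auto simp: a_def b_def c_def add.commute[of "unit_deg y"])
  have "a + unit_deg z = \<gamma>" "b + unit_deg x = \<gamma>" "c + unit_deg y = \<gamma>"
    by (simp_all add: a_def b_def c_def \<gamma>_def ac_simps)
  then have abc: "a \<le> \<gamma>" "b \<le> \<gamma>" "c \<le> \<gamma>"
    by (metis le_add_same_cancel1 unit_deg_nonneg)+
  have \<gamma>: "sum \<gamma> UNIV = 3"
    by (simp add: \<gamma>_def sum.distrib unit_deg_def of_bool_def)
  have "sym (parcs H)"
    unfolding H by (auto intro: symI)
  then have "{a, b, c} \<subseteq> edge_degs H"
    using xyz by (simp add: a_def b_def c_def edge_degs_iff H)
  then have "edge_degs_le H \<gamma> = {a, b, c}"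
    using abc edge_degs_le_triangle[of H x y z] xyz(4-6)
    by (auto simp: H edge_degs_le_def a_def b_def c_def \<gamma>_def)
  then have "2 \<le> fv.dim (zero_sum (edge_degs_le G \<gamma>) :: ('v mdeg \<Rightarrow> 'k) set)"
    using le[of \<gamma>] dim_zero_sum_triple[OF dist, where 'k = 'k]
    unfolding graph_betti_1_triangle[OF \<gamma>] by simp
  moreover have "a \<notin> edge_degs G"
    using \<open>(x, y) \<notin> parcs G\<close> edge_degs_iff[OF G(1) xyz(4)] by (simp add: a_def)
  then have "edge_degs_le G \<gamma> \<subseteq> {b, c}"
    using edge_degs_le_triangle[of G x y z] G(2) xyz(4-6)
    by (auto simp: edge_degs_le_def a_def b_def c_def \<gamma>_def)
  then have "fv.dim (zero_sum (edge_degs_le G \<gamma>) :: ('v mdeg \<Rightarrow> 'k) set) \<le> 1"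
    using dist(3) by (rule dim_zero_sum_pair)
  ultimately show False
    by simp
qed

text \<open>Edges of \<open>H\<close> have degree 0 at \<open>v\<close>, so those below \<gamma> are
  already below \<open>\<gamma> - unit_deg v\<close>, and every syzygy of degree \<gamma> comes from
  a smaller degree. If \<open>\<gamma> v < 0\<close>, no edge lies below \<gamma> at all.\<close>

lemma graph_betti_1_outside:
  fixes H :: "'v::finite pair_pre_digraph"
  assumes H: "parcs H \<subseteq> S \<times> S" and v: "v \<notin> S" "\<gamma> v \<noteq> 0"
  shows "graph_betti TYPE('k::field) 1 \<gamma> H = 0"
proof -
  have "\<alpha> \<le> \<gamma> - unit_deg v" if \<alpha>: "\<alpha> \<in> edge_degs H" "\<alpha> \<le> \<gamma>" for \<alpha>
  proof -
    have "\<alpha> v = 0"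
      using \<alpha>(1) H v(1) by (auto simp: edge_degs_def unit_deg_def)
    then have "1 \<le> \<gamma> v"
      using le_funD[OF \<alpha>(2), of v] v(2) by simp
    then show ?thesis
      using \<alpha>(2) \<open>\<alpha> v = 0\<close> by (auto simp: le_fun_def unit_deg_def)
  qed
  then have "edge_degs_le H \<gamma> \<subseteq> edge_degs_le H (\<gamma> - unit_deg v)"
    by (auto simp: edge_degs_le_def)
  then have "(zero_sum (edge_degs_le H \<gamma>) :: ('v mdeg \<Rightarrow> 'k) set) \<subseteq> zero_sum (edge_degs_le H (\<gamma> - unit_deg v))"
    by (rule zero_sum_mono) (simp add: edge_degs_le_def)
  moreover have "(zero_sum (edge_degs_le H (\<gamma> - unit_deg w)) :: ('v mdeg \<Rightarrow> 'k) set) \<subseteq> zero_sum (edge_degs_le H \<gamma>)" for w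
  proof (rule zero_sum_mono)
    have "\<gamma> - unit_deg w \<le> \<gamma>"
      by simp
    then show "edge_degs_le H (\<gamma> - unit_deg w) \<subseteq> edge_degs_le H \<gamma>"
      by (auto simp: edge_degs_le_def intro: order_trans)
  qed (simp add: edge_degs_le_def)
  ultimately have "(\<Union>w. zero_sum (edge_degs_le H (\<gamma> - unit_deg w)) :: ('v mdeg \<Rightarrow> 'k) set) = zero_sum (edge_degs_le H \<gamma>)"
    by blast
  then show ?thesis
    unfolding graph_betti_1 by simp
qed

text \<open>Both ends of an edge below \<gamma> are vertices where \<gamma> is positive, hence in
  \<open>S\<close>. So the two graphs have the same edges below every \<delta> \<le> \<gamma>, and
  the formula sees no others.\<close>

lemma graph_betti_1_induced:
  fixes G H :: "'v::finite pair_pre_digraph"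
  assumes H: "parcs H = parcs G \<inter> S \<times> S" and \<gamma>: "\<And>v. v \<notin> S \<Longrightarrow> \<gamma> v \<le> 0"
  shows "graph_betti TYPE('k::field) 1 \<gamma> H = graph_betti TYPE('k) 1 \<gamma> G"
proof -
  have "edge_degs_le H \<delta> = edge_degs_le G \<delta>" if "\<delta> \<le> \<gamma>" for \<delta>
  proof -
    have "\<alpha> \<in> edge_degs H" if \<alpha>: "\<alpha> \<in> edge_degs G" "\<alpha> \<le> \<delta>" for \<alpha>
    proof -
      obtain x y where xy: "(x, y) \<in> parcs G" "\<alpha> = unit_deg x + unit_deg y"
        using \<alpha>(1) by (auto simp: edge_degs_def)
      have "\<alpha> \<le> \<gamma>"
        using \<alpha>(2) \<open>\<delta> \<le> \<gamma>\<close> by (rule order_trans)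
      then have "1 \<le> \<gamma> x" "1 \<le> \<gamma> y"
        using le_funD[of \<alpha> \<gamma> x] le_funD[of \<alpha> \<gamma> y]
        by (auto simp: xy(2) unit_deg_def of_bool_def split: if_splits)
      then have "x \<in> S" "y \<in> S"
        using \<gamma>[of x] \<gamma>[of y] by auto
      then show ?thesis
        using xy H by (auto simp: edge_degs_def)
    qed
    moreover have "edge_degs H \<subseteq> edge_degs G"
      using H by (auto simp: edge_degs_def)
    ultimately show ?thesis
      by (auto simp: edge_degs_le_def)
  qed
  then show ?thesis
    unfolding graph_betti_1 by simp
qed

text \<open>The case \<open>m = 2\<close> has to be excluded: a single edge generates a principal
  ideal, which is free, so its first Betti numbers vanish and the inequality cannot detect whether
  the edge is in \<open>G\<close>.\<close>

theorem theorem1p2: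
  fixes G H :: "('v::finite) pair_pre_digraph" and m :: nat
  assumes "pair_graph G" and "pverts G = UNIV"
    and "complete_digraph m (with_proj H)" and "pverts H \<subseteq> pverts G"
    and "m \<noteq> 2"
  shows "(\<forall>\<alpha> :: 'v \<Rightarrow> int.
            graph_betti TYPE('k::field) 1 \<alpha> H \<le> graph_betti TYPE('k) 1 \<alpha> G)
         \<longleftrightarrow> subgraph (with_proj H) (with_proj G)"
proof -
  interpret G: pair_graph G by fact
  interpret H: pair_graph H
    using assms(3) by (rule pair_graphI_complete)
  have H: "card (pverts H) = m" "parcs H = {(x, y). x \<in> pverts H \<and> y \<in> pverts H \<and> x \<noteq> y}"
    using assms(3) by (auto simp: complete_digraph_pair_def)
  have G: "sym (parcs G)" "(u, u) \<notin> parcs G" for u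
    using G.sym_arcs G.no_loops' by (auto simp: symmetric_def)
  have sub: "subgraph (with_proj H) (with_proj G) \<longleftrightarrow> parcs H \<subseteq> parcs G"
    using assms(2) G.wf_digraph_axioms H.wf_digraph_axioms
    by (auto simp: subgraph_def compatible_def)
  show ?thesis
    unfolding sub
  proof
    assume le: "\<forall>\<alpha>. graph_betti TYPE('k) 1 \<alpha> H \<le> graph_betti TYPE('k) 1 \<alpha> G"
    show "parcs H \<subseteq> parcs G"
    proof safe
      fix x y assume "(x, y) \<in> parcs H"
      then have xy: "x \<in> pverts H" "y \<in> pverts H" "x \<noteq> y"
        using H(2) by auto
      \<comment> \<open>Having an edge, \<open>H\<close> has at least two vertices, so
        \<open>m \<noteq> 2\<close> supplies the third corner of a triangle.\<close>
      have "pverts H \<noteq> {x, y}"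
        using H(1) assms(5) xy(3) by auto
      then obtain z where "z \<in> pverts H" "x \<noteq> z" "y \<noteq> z"
        using xy by blast
      then show "(x, y) \<in> parcs G"
        using graph_betti_1_le_imp_arc[OF H(2) G] le xy by blast
    qed
  next
    assume HG: "parcs H \<subseteq> parcs G"
    \<comment> \<open>A complete subgraph is induced, because \<open>G\<close> has no loops.\<close>
    then have ind: "parcs H = parcs G \<inter> pverts H \<times> pverts H"
      using G(2) H(2) by auto
    show "\<forall>\<alpha>. graph_betti TYPE('k) 1 \<alpha> H \<le> graph_betti TYPE('k) 1 \<alpha> G"
    proof
      fix \<alpha> :: "'v \<Rightarrow> int"
      show "graph_betti TYPE('k) 1 \<alpha> H \<le> graph_betti TYPE('k) 1 \<alpha> G"
      proof (cases "\<exists>v. v \<notin> pverts H \<and> \<alpha> v \<noteq> 0")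
        case True
        then show ?thesis
          using graph_betti_1_outside[of H "pverts H"] ind by (metis inf_le2 zero_le)
      next
        case False
        then show ?thesis
          by (intro eq_refl graph_betti_1_induced[OF ind]) auto
      qed
    qed
  qed
qed

end
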